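(* Let $\Lambda$ be the limit set of a CIFS $\{S_i\}_{i\in\mathcal{I}}$ on $\mathbb{R}^d$, and let $F$ be the set of fixed points of the maps $S_i$, $i\in\mathcal{I}$. Then $\underline{\dim}_{\mathrm B}\Lambda=\overline{\dim}_{\mathrm B}\Lambda$ if and only if $$\overline{\dim}_{\mathrm B}F\leq\max\{\dim_{\mathrm H}\Lambda,\ \underline{\dim}_{\mathrm B}F\}.$$
   Context: For a non-empty bounded set $E\subset\mathbb{R}^d$, $N_r(E)$ is the least number of open balls of radius $r$ required to cover $E$; $\underline{\dim}_{\mathrm B}E=\liminf_{r\to0}\frac{\log N_r(E)}{\log(1/r)}$ and $\overline{\dim}_{\mathrm B}E=\limsup_{r\to0}\frac{\log N_r(E)}{\log(1/r)}$ are the lower and upper box dimensions; $\dim_{\mathrm H}$ is Hausdorff dimension. CIFS. Let $d\in\mathbb{N}$, let $X\subset\mathbb{R}^d$ (Euclidean norm) be compact and connected, and let $\mathcal{I}$ be a non-empty countable index set. Let $S_i\colon X\to X$ ($i\in\mathcal{I}$) be injective and uniformly contracting: there is $0<c<1$ with $0<\|S_i(x)-S_i(y)\|\leq c\|x-y\|$ for all $i\in\mathcal{I}$ and all distinct $x,y\in X$. Let $\mathcal{I}^*=\bigcup_{n\geq0}\mathcal{I}^n$ be the set of finite words; for $\mathtt{i}=(i_1,\dots,i_n)$ write $S_{\mathtt{i}}=S_{i_1}\circ\cdots\circ S_{i_n}$ (the identity for the empty word). For $\gamma\in\mathcal{I}^{\mathbb{N}}$, $\gamma|_n\in\mathcal{I}^n$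 is its prefix of length $n$. The limit set (attractor) is $\Lambda=\bigcup_{\gamma\in\mathcal{I}^{\mathbb{N}}}\bigcap_{n=1}^\infty S_{\gamma|_n}(X)$. The family $\{S_i\}_{i\in\mathcal{I}}$ is called a CIFS if: (i) Conformality: there is an open, bounded, connected $V\subset\mathbb{R}^d$ with $X\subset V$ such that each $S_i$ extends to a conformal $C^{1+\varepsilon}$ diffeomorphism on $V$ (of $V$ onto its image in $V$). (ii) Bounded distortion: there is $K\geq1$ with $\|S_{\mathtt{i}}'(x)\|\leq K\|S_{\mathtt{i}}'(y)\|$ for all $x,y\in V$, $\mathtt{i}\in\mathcal{I}^*$, where $S_{\mathtt{i}}'(x)$ is the Jacobian matrix and $\|\cdot\|$ the spectral norm. (iii) Open set condition: $X$ has non-empty interior $U$, $S_i(U)\subset U$ for all $i$, and $S_i(U)\cap S_j(U)=\varnothing$ for $i\neq j$. (iv) Cone condition: $\inf_{x\in X}\inf_{r\in(0,1)}r^{-d}\mathcal{L}^d(B(x,r)\cap U)>0$, where $\mathcal{L}^d$ is Lebesgue measure and $B(x,r)$ the open ball. *)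

theory Defs
  imports "HOL-Analysis.Analysis"
begin

section \<open>Box and Hausdorff dimensions\<close>

text \<open>The centres of the balls need not lie in \<open>E\<close>. All dimensions below take values in the
  extended reals; the box dimensions are only meaningful for non-empty bounded sets.\<close>

definition covering_number :: "real \<Rightarrow> 'a::metric_space set \<Rightarrow> nat" where
  "covering_number r E = (LEAST n. \<exists>C. finite C \<and> card C = n \<and> E \<subseteq> (\<Union>x\<in>C. ball x r))"

definition lower_box_dim :: "'a::metric_space set \<Rightarrow> ereal" where
  "lower_box_dim E =
     Liminf (at_right 0) (\<lambda>r::real. ereal (ln (real (covering_number r E)) / ln (1 / r)))"

definition upper_box_dim :: "'a::metric_space set \<Rightarrow> ereal" where
  "upper_box_dim E =
     Limsup (at_right 0) (\<lambda>r::real. ereal (ln (real (covering_number r E)) / ln (1 / r)))"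

text \<open>The weight \<open>|A|\<^sup>s\<close> of a covering set. The case distinction implements the usual conventions
  \<open>|{}|\<^sup>s = 0\<close> and \<open>|A|\<^sup>0 = 1\<close> for non-empty \<open>A\<close>, since \<open>0 powr 0 = 0\<close>.\<close>

definition diam_weight :: "real \<Rightarrow> 'a::metric_space set \<Rightarrow> ennreal" where
  "diam_weight s A =
     (if A = {} then 0 else if s = 0 then 1 else ennreal (diameter A powr s))"

text \<open>Boundedness of the covering sets is explicit because \<open>diameter\<close> is unspecified
  on unbounded sets.\<close>

definition hausdorff_premeasure :: "real \<Rightarrow> real \<Rightarrow> 'a::metric_space set \<Rightarrow> ennreal" where
  "hausdorff_premeasure \<delta> s E =
     (INF A \<in> {A :: nat \<Rightarrow> 'a set. E \<subseteq> (\<Union>n. A n) \<and> (\<forall>n. bounded (A n) \<and> diameter (A n) \<le> \<delta>)}.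
        \<Sum>n. diam_weight s (A n))"

definition hausdorff_measure :: "real \<Rightarrow> 'a::metric_space set \<Rightarrow> ennreal" where
  "hausdorff_measure s E = (SUP \<delta> \<in> {0<..}. hausdorff_premeasure \<delta> s E)"

definition hausdorff_dim :: "'a::metric_space set \<Rightarrow> ereal" where
  "hausdorff_dim E = Inf (ereal ` {s. 0 \<le> s \<and> hausdorff_measure s E = 0})"


section \<open>Conformal diffeomorphisms\<close>

definition spectral_norm :: "real^'n^'m \<Rightarrow> real" where
  "spectral_norm A = onorm ((*v) A)"

text \<open>Class \<open>C\<^sup>1\<^sup>+\<^sup>\<epsilon>\<close> on an open set: differentiable, with locally \<open>\<epsilon>\<close>-Hoelder continuous derivative.\<close>

definition C1_holder_on :: "real \<Rightarrow> (real^'n \<Rightarrow> real^'n) \<Rightarrow> (real^'n) set \<Rightarrow> bool" where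
  "C1_holder_on \<epsilon> f V \<longleftrightarrow>
     (\<forall>x\<in>V. f differentiable (at x)) \<and>
     (\<forall>z\<in>V. \<exists>\<delta>>0. \<exists>C. \<forall>x \<in> V \<inter> ball z \<delta>. \<forall>y \<in> V \<inter> ball z \<delta>.
        spectral_norm (jacobian f (at x) - jacobian f (at y)) \<le> C * dist x y powr \<epsilon>)"

definition C1_holder_diffeo_on :: "real \<Rightarrow> (real^'n \<Rightarrow> real^'n) \<Rightarrow> (real^'n) set \<Rightarrow> bool" where
  "C1_holder_diffeo_on \<epsilon> f V \<longleftrightarrow>
     inj_on f V \<and> open (f ` V) \<and>
     C1_holder_on \<epsilon> f V \<and> C1_holder_on \<epsilon> (inv_into V f) (f ` V)"

definition conformal_on :: "(real^'n \<Rightarrow> real^'n) \<Rightarrow> (real^'n) set \<Rightarrow> bool" where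
  "conformal_on f V \<longleftrightarrow>
     (\<forall>x\<in>V. \<exists>a>0. \<exists>Q. orthogonal_transformation Q \<and>
        (f has_derivative (\<lambda>h. a *\<^sub>R Q h)) (at x))"


section \<open>Conformal iterated function systems\<close>

primrec word_map :: "('i \<Rightarrow> 'a \<Rightarrow> 'a) \<Rightarrow> 'i list \<Rightarrow> 'a \<Rightarrow> 'a" where
  "word_map S [] = id"
| "word_map S (i # w) = S i \<circ> word_map S w"

definition limit_set :: "'a set \<Rightarrow> 'i set \<Rightarrow> ('i \<Rightarrow> 'a \<Rightarrow> 'a) \<Rightarrow> 'a set" where
  "limit_set X I S =
     (\<Union>\<gamma> \<in> {\<gamma> :: nat \<Rightarrow> 'i. range \<gamma> \<subseteq> I}. \<Inter>n \<in> {1..}. word_map S (map \<gamma> [0..<n]) ` X)"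

definition fixed_points :: "'a set \<Rightarrow> 'i set \<Rightarrow> ('i \<Rightarrow> 'a \<Rightarrow> 'a) \<Rightarrow> 'a set" where
  "fixed_points X I S = {x \<in> X. \<exists>i\<in>I. S i x = x}"

text \<open>Only the values of \<open>S i\<close> on \<open>X\<close> (for \<open>i \<in> I\<close>) matter. The map \<open>T i\<close> is the extension of
  \<open>S i\<close> to \<open>V\<close>. Conformality and bounded distortion form one assumption because they refer to the
  same \<open>V\<close> and the same extensions.\<close>

locale CIFS =
  fixes X :: "(real^'d) set" and I :: "'i set" and S :: "'i \<Rightarrow> real^'d \<Rightarrow> real^'d"
  assumes compact_X: "compact X"
    and connected_X: "connected X"
    and index_nonempty: "I \<noteq> {}"
    and index_countable: "countable I"
    and maps_into: "\<And>i. i \<in> I \<Longrightarrow> S i ` X \<subseteq> X"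
    and injective: "\<And>i. i \<in> I \<Longrightarrow> inj_on (S i) X"
    and uniformly_contracting:
      "\<exists>c. 0 < c \<and> c < 1 \<and> (\<forall>i\<in>I. \<forall>x\<in>X. \<forall>y\<in>X. x \<noteq> y \<longrightarrow>
         0 < norm (S i x - S i y) \<and> norm (S i x - S i y) \<le> c * norm (x - y))"
    and conformality_and_bounded_distortion:
      "\<exists>V T. open V \<and> bounded V \<and> connected V \<and> X \<subseteq> V \<and>
         (\<exists>\<epsilon>. 0 < \<epsilon> \<and> \<epsilon> \<le> 1 \<and> (\<forall>i\<in>I.
            (\<forall>x\<in>X. T i x = S i x) \<and> T i ` V \<subseteq> V \<and>
            conformal_on (T i) V \<and> C1_holder_diffeo_on \<epsilon> (T i) V)) \<and>
         (\<exists>K\<ge>1. \<forall>w \<in> lists I. \<forall>x\<in>V. \<forall>y\<in>V.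
            spectral_norm (jacobian (word_map T w) (at x))
              \<le> K * spectral_norm (jacobian (word_map T w) (at y)))"
    and interior_nonempty: "interior X \<noteq> {}"
    and interior_invariant: "\<And>i. i \<in> I \<Longrightarrow> S i ` interior X \<subseteq> interior X"
    and interior_disjoint:
      "\<And>i j. i \<in> I \<Longrightarrow> j \<in> I \<Longrightarrow> i \<noteq> j \<Longrightarrow> S i ` interior X \<inter> S j ` interior X = {}"
    and cone_condition:
      "(INF x\<in>X. INF r\<in>{0<..<1}.
          emeasure lebesgue (ball x r \<inter> interior X) / ennreal (r ^ CARD('d))) > 0"

end

theory Submission
  imports Defs "HOL-Library.Sublist"
begin

text \<open>Write \<open>h\<close> for the Hausdorff dimension of the limit set and \<open>\<rho>\<^sub>w\<close> for the norm of the
  derivative of \<open>S\<^sub>w\<close> at a fixed interior point. Bounded distortion makes \<open>\<rho>\<close> multiplicative up to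
  constants, and the open set condition bounds the number of cylinders of size comparable to \<open>r\<close>
  meeting a ball of radius \<open>r\<close>; a mass distribution argument on finite subsystems, with weights
  \<open>\<rho>\<^sub>w\<^sup>t\<close>, then gives convergence of the sum of \<open>\<rho>\<^sub>w\<^sup>t\<close> over all words for \<open>t > h\<close>. A cylinder of size
  below \<open>r\<close> is within distance comparable to \<open>r\<close> of a fixed point of its last map, transported by the
  preceding word \<open>w\<close>, so up to constants the limit set has covering number at most the sum of
  \<open>N\<^bsub>r/\<rho>\<^sub>w\<^esub>(F)\<close> over the words with \<open>\<rho>\<^sub>w \<ge> r\<close>, hence at most the supremum of \<open>(R/r)\<^sup>t N\<^sub>R(F)\<close> over
  \<open>r \<le> R \<le> 1\<close>. Used at all scales this bounds the upper box dimension by the maximum of \<open>h\<close> and that of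
  \<open>F\<close>. If the upper box dimension of \<open>F\<close> exceeds both \<open>h\<close> and the lower one, then the bound at scales
  where \<open>F\<close> is thin puts the lower box dimension of the limit set strictly below the upper one.\<close>

section \<open>Covering numbers and dimensions\<close>

lemma covering_number_le:
  assumes "finite C" "E \<subseteq> (\<Union>x\<in>C. ball x r)"
  shows "covering_number r E \<le> card C"
  unfolding covering_number_def using assms by (intro Least_le exI[of _ C]) simp

lemma covering_number_cover:
  fixes E :: "'a::heine_borel set"
  assumes "bounded E" "0 < r"
  obtains C where "finite C" "card C = covering_number r E" "E \<subseteq> (\<Union>x\<in>C. ball x r)"
proof -
  have "compact (closure E)"
    using assms(1) by (simp add: compact_closure)
  then obtain C where "finite C" "closure E \<subseteq> (\<Union>x\<in>C. ball x r)"
    using assms(2) compact_eq_totally_bounded[of "closure E"] by meson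
  then have "\<exists>n C. finite C \<and> card C = n \<and> E \<subseteq> (\<Union>x\<in>C. ball x r)"
    using closure_subset by blast
  then have "\<exists>C. finite C \<and> card C = covering_number r E \<and> E \<subseteq> (\<Union>x\<in>C. ball x r)"
    unfolding covering_number_def by (rule LeastI_ex)
  then show thesis using that by blast
qed

lemma covering_number_mono:
  fixes E :: "'a::heine_borel set"
  assumes "bounded F" "E \<subseteq> F" "0 < r"
  shows "covering_number r E \<le> covering_number r F"
proof -
  obtain C where "finite C" "card C = covering_number r F" "F \<subseteq> (\<Union>x\<in>C. ball x r)"
    using covering_number_cover[OF assms(1,3)] .
  then show ?thesis
    using covering_number_le[of C E r] assms(2) by auto
qed

lemma covering_number_antimono:
  fixes E :: "'a::heine_borel set"
  assumes "bounded E" "0 < r" "r \<le> r'"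
  shows "covering_number r' E \<le> covering_number r E"
proof -
  obtain C where C: "finite C" "card C = covering_number r E" "E \<subseteq> (\<Union>x\<in>C. ball x r)"
    using covering_number_cover[OF assms(1,2)] .
  moreover have "E \<subseteq> (\<Union>x\<in>C. ball x r')"
    using C(3) subset_ball[OF assms(3)] by blast
  ultimately show ?thesis
    using covering_number_le[of C E r'] by auto
qed

lemma covering_number_ge_1:
  fixes E :: "'a::heine_borel set"
  assumes "bounded E" "E \<noteq> {}" "0 < r"
  shows "1 \<le> covering_number r E"
proof -
  obtain C where C: "finite C" "card C = covering_number r E" "E \<subseteq> (\<Union>x\<in>C. ball x r)"
    using covering_number_cover[OF assms(1,3)] .
  then have "C \<noteq> {}" using assms(2) by auto
  then have "0 < card C" using C(1) by (simp add: card_gt_0_iff)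
  then show ?thesis using C(2) by simp
qed

text \<open>Compares the total Lebesgue measure of the small balls with that of the large one; the
  volume of the unit ball cancels.\<close>

lemma card_disjoint_balls_le:
  fixes c :: "'i \<Rightarrow> 'a::euclidean_space"
  assumes "finite A" "0 < s" "0 \<le> R"
    and "\<And>i. i \<in> A \<Longrightarrow> ball (c i) s \<subseteq> ball z R"
    and "disjoint_family_on (\<lambda>i. ball (c i) s) A"
  shows "real (card A) \<le> (R / s) ^ DIM('a)"
proof -
  let ?u = "unit_ball_vol (real DIM('a))"
  have u: "0 < ?u" by simp
  have "real (card A) * (?u * s ^ DIM('a)) = (\<Sum>i\<in>A. measure lborel (ball (c i) s))"
    using assms(2) by (simp add: content_ball)
  also have "\<dots> = measure lborel (\<Union>i\<in>A. ball (c i) s)"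
    by (rule measure_finite_Union[symmetric]) (use assms in \<open>auto simp: emeasure_lborel_ball_finite less_top[symmetric] emeasure_ball\<close>)
  also have "\<dots> \<le> measure lborel (ball z R)"
    by (rule measure_mono_fmeasurable) (use assms(1,4) emeasure_lborel_ball_finite[of z R] in \<open>auto simp: fmeasurable_def\<close>)
  also have "\<dots> = ?u * R ^ DIM('a)"
    using assms(3) by (simp add: content_ball)
  finally show ?thesis
    using u assms(2) by (simp add: power_divide field_simps)
qed

text \<open>A largest \<open>r\<close>-separated subset of \<open>E\<close> is the set of centres of
  a cover, and the balls of half the radius about it are disjoint. This crude bound serves to keep
  the upper box dimension finite.\<close>

lemma covering_number_polynomial_bound:
  fixes E :: "'a::euclidean_space set"
  assumes "bounded E"
  obtains A where "0 < A" "\<And>r. 0 < r \<Longrightarrow> r \<le> 1 \<Longrightarrow> real (covering_number r E) \<le> A * r powr - real DIM('a)"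
proof -
  obtain b where b: "0 < b" "\<And>x. x \<in> E \<Longrightarrow> norm x < b"
    using assms bounded_pos_less by metis
  define A where "A = (2 * (b + 1)) ^ DIM('a)"
  have "real (covering_number r E) \<le> A * r powr - real DIM('a)" if r: "0 < r" "r \<le> 1" for r
  proof -
    let ?P = "\<lambda>C. finite C \<and> C \<subseteq> E \<and> pairwise (\<lambda>x y. r \<le> dist x y) C"
    have bound: "real (card C) \<le> A * r powr - real DIM('a)" if "?P C" for C
    proof -
      have "real (card C) \<le> ((b + 1) / (r / 2)) ^ DIM('a)"
      proof (rule card_disjoint_balls_le[where c = id and z = 0])
        show "ball (id x) (r / 2) \<subseteq> ball 0 (b + 1)" if "x \<in> C" for x
        proof
          fix y assume "y \<in> ball (id x) (r / 2)"
          then have "dist x y < 1" using r by simp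
          moreover have "norm x < b" using b(2) that \<open>?P C\<close> by blast
          ultimately show "y \<in> ball 0 (b + 1)"
            using dist_triangle[of 0 y x] by simp
        qed
        show "disjoint_family_on (\<lambda>x. ball (id x) (r / 2)) C"
          unfolding disjoint_family_on_def
        proof (intro ballI impI)
          fix x y assume "x \<in> C" "y \<in> C" "x \<noteq> y"
          then have "r \<le> dist x y" using \<open>?P C\<close> by (auto simp: pairwise_def)
          then show "ball (id x) (r / 2) \<inter> ball (id y) (r / 2) = {}"
            by (simp add: disjoint_ballI)
        qed
      qed (use \<open>?P C\<close> r b in auto)
      also have "\<dots> = A * r powr - real DIM('a)"
      proof -
        have "r powr - real DIM('a) = inverse (r ^ DIM('a))"
          using r by (simp only: powr_minus powr_realpow)
        then have "A * r powr - real DIM('a) = (2 * (b + 1) / r) ^ DIM('a)"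
          unfolding power_divide by (simp only: A_def divide_inverse)
        then show ?thesis by (simp add: mult.commute)
      qed
      finally show ?thesis .
    qed
    have "\<exists>C. ?P C \<and> (\<forall>D. ?P D \<longrightarrow> card D \<le> card C)"
    proof (rule Lattices_Big.ex_has_greatest_nat)
      show "?P {}" by simp
      show "\<forall>C. ?P C \<longrightarrow> card C < Suc (nat \<lceil>A * r powr - real DIM('a)\<rceil>)"
        unfolding less_Suc_eq_le
        using bound by (metis of_nat_le_iff order_trans real_nat_ceiling_ge)
    qed
    then obtain C where C: "?P C" and max: "\<And>D. ?P D \<Longrightarrow> card D \<le> card C" by blast
    have "E \<subseteq> (\<Union>x\<in>C. ball x r)"
    proof
      fix y assume y: "y \<in> E"
      show "y \<in> (\<Union>x\<in>C. ball x r)"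
      proof (rule ccontr)
        assume "y \<notin> (\<Union>x\<in>C. ball x r)"
        then have far: "\<And>x. x \<in> C \<Longrightarrow> r \<le> dist x y" by force
        then have "y \<notin> C" using r by fastforce
        have "?P (insert y C)"
          using C far y by (auto simp: pairwise_insert dist_commute)
        from max[OF this] show False using C \<open>y \<notin> C\<close> by simp
      qed
    qed
    then have "covering_number r E \<le> card C"
      using C covering_number_le by blast
    then show ?thesis using bound[OF C] by linarith
  qed
  moreover have "0 < A" using b by (simp add: A_def)
  ultimately show thesis using that by blast
qed

section \<open>Box dimensions as power bounds at small radii\<close>

lemma eventually_at_right_0_iff:
  "eventually P (at_right (0::real)) \<longleftrightarrow> (\<exists>b>0. \<forall>r. 0 < r \<longrightarrow> r < b \<longrightarrow> P r)"
  by (simp add: eventually_at_right_field)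

lemma frequently_at_right_0_iff:
  "frequently P (at_right (0::real)) \<longleftrightarrow> (\<forall>b>0. \<exists>r. 0 < r \<and> r < b \<and> P r)"
  unfolding frequently_def eventually_at_right_0_iff by blast

text \<open>Dictionary between the quotients defining the box dimensions and power bounds on
  covering numbers; for \<open>r < 1\<close> the denominator is positive and can be multiplied
  out.\<close>

lemma ln_div_ln_inverse_le_iff:
  fixes r :: real
  assumes "0 < r" "r < 1" "0 < N"
  shows "ln N / ln (1 / r) \<le> t \<longleftrightarrow> N \<le> r powr - t"
proof -
  have "ln (1 / r) = - ln r" "0 < - ln r" using assms by (auto simp: ln_div)
  then have "ln N / ln (1 / r) \<le> t \<longleftrightarrow> ln N \<le> - t * ln r"
    by (simp only: pos_divide_le_eq) (simp add: algebra_simps)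
  also have "\<dots> \<longleftrightarrow> N \<le> r powr - t"
    using assms ln_le_cancel_iff[of N "r powr - t"] by (simp add: ln_powr)
  finally show ?thesis .
qed

text \<open>Multiplicative constants are absorbed by an arbitrarily small increase of the exponent,
  because \<open>r powr (t' - t)\<close> tends to 0.\<close>

lemma eventually_const_mult_powr_le:
  fixes t t' A :: real
  assumes "t < t'"
  shows "eventually (\<lambda>r::real. A * r powr - t \<le> r powr - t') (at_right 0)"
proof -
  have "((\<lambda>r. r powr (t' - t)) \<longlongrightarrow> 0) (at_right 0)"
    using assms by (intro tendsto_zero_powrI[where b="t'-t"]) (auto intro!: tendsto_intros intro: eventually_mono[OF eventually_at_right_less])
  then have "eventually (\<lambda>r. r powr (t' - t) < 1 / (\<bar>A\<bar> + 1)) (at_right 0)"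
    by (rule order_tendstoD) simp
  then show ?thesis
    using eventually_at_right_less
  proof eventually_elim
    case (elim r)
    have "A * r powr - t = A * r powr (t' - t) * r powr - t'"
      by (simp add: powr_add[symmetric] mult.assoc)
    also have "\<dots> \<le> (\<bar>A\<bar> + 1) * r powr (t' - t) * r powr - t'"
      by (intro mult_right_mono) auto
    also have "\<dots> \<le> 1 * r powr - t'"
      using elim by (intro mult_right_mono) (auto simp: field_simps)
    finally show ?case by simp
  qed
qed

lemma upper_box_dim_leI:
  fixes E :: "'a::heine_borel set"
  assumes E: "bounded E" "E \<noteq> {}"
    and ev: "eventually (\<lambda>r. real (covering_number r E) \<le> A * r powr - t) (at_right 0)"
  shows "upper_box_dim E \<le> ereal t"
proof (rule ereal_le_epsilon2)
  fix e :: real assume "0 < e"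
  then have less: "t < t + e" by simp
  have "eventually (\<lambda>r. ereal (ln (real (covering_number r E)) / ln (1 / r)) \<le> ereal (t + e)) (at_right 0)"
    using ev eventually_const_mult_powr_le[OF less, of A] eventually_at_right_real[OF zero_less_one]
  proof eventually_elim
    case (elim r)
    then have "0 < real (covering_number r E)"
      using covering_number_ge_1[OF E, of r] by simp
    with elim show ?case
      using \<open>0 < e\<close> by (subst ereal_less_eq, subst ln_div_ln_inverse_le_iff) auto
  qed
  then show "upper_box_dim E \<le> ereal t + ereal e"
    unfolding upper_box_dim_def by (simp add: Limsup_bounded)
qed

lemma upper_box_dim_lessD:
  fixes E :: "'a::heine_borel set"
  assumes E: "bounded E" "E \<noteq> {}" and less: "upper_box_dim E < ereal t"
  shows "eventually (\<lambda>r. real (covering_number r E) \<le> r powr - t) (at_right 0)"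
  using Limsup_lessD[OF less[unfolded upper_box_dim_def]] eventually_at_right_real[OF zero_less_one]
proof eventually_elim
  case (elim r)
  then have "0 < real (covering_number r E)"
    using covering_number_ge_1[OF E, of r] by simp
  with elim ln_div_ln_inverse_le_iff[of r "real (covering_number r E)" t] show ?case by auto
qed

text \<open>Arbitrarily small scales suffice for a liminf: were it above \<open>t + e\<close>, the
  counts would exceed \<open>A * r powr - t\<close> at all small scales.\<close>

lemma lower_box_dim_leI:
  fixes E :: "'a::heine_borel set"
  assumes E: "bounded E" "E \<noteq> {}"
    and fr: "frequently (\<lambda>r. real (covering_number r E) \<le> A * r powr - t) (at_right 0)"
  shows "lower_box_dim E \<le> ereal t"
proof (rule ereal_le_epsilon2)
  fix e :: real assume "0 < e"
  then have less: "t < t + e" by simp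
  show "lower_box_dim E \<le> ereal t + ereal e"
  proof (rule ccontr)
    assume "\<not> ?thesis"
    then have "ereal (t + e) < lower_box_dim E" by simp
    from less_LiminfD[OF this[unfolded lower_box_dim_def]]
    have "eventually (\<lambda>r. \<not> real (covering_number r E) \<le> A * r powr - t) (at_right 0)"
      using eventually_const_mult_powr_le[OF less, of A] eventually_at_right_real[OF zero_less_one]
    proof eventually_elim
      case (elim r)
      then have "0 < real (covering_number r E)"
        using covering_number_ge_1[OF E, of r] by simp
      with elim ln_div_ln_inverse_le_iff[of r "real (covering_number r E)" "t + e"] show ?case by auto
    qed
    then show False using fr by (simp add: frequently_def)
  qed
qed

lemma lower_box_dim_lessD:
  fixes E :: "'a::heine_borel set"
  assumes E: "bounded E" "E \<noteq> {}" and less: "lower_box_dim E < ereal t"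
  shows "frequently (\<lambda>r. real (covering_number r E) \<le> r powr - t) (at_right 0)"
proof (rule ccontr)
  assume "\<not> ?thesis"
  then have "eventually (\<lambda>r. \<not> real (covering_number r E) \<le> r powr - t) (at_right 0)"
    by (simp add: frequently_def)
  then have "eventually (\<lambda>r. ereal t \<le> ereal (ln (real (covering_number r E)) / ln (1 / r))) (at_right 0)"
    using eventually_at_right_real[OF zero_less_one]
  proof eventually_elim
    case (elim r)
    then have "0 < real (covering_number r E)"
      using covering_number_ge_1[OF E, of r] by simp
    with elim ln_div_ln_inverse_le_iff[of r "real (covering_number r E)" t] show ?case by auto
  qed
  then have "ereal t \<le> lower_box_dim E"
    unfolding lower_box_dim_def by (rule Liminf_bounded)
  then show False using less by simp
qed

lemma lower_box_dim_nonneg: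
  fixes E :: "'a::heine_borel set"
  assumes E: "bounded E" "E \<noteq> {}"
  shows "0 \<le> lower_box_dim E"
  unfolding lower_box_dim_def
proof (rule Liminf_bounded)
  show "eventually (\<lambda>r. 0 \<le> ereal (ln (real (covering_number r E)) / ln (1 / r))) (at_right 0)"
    using eventually_at_right_real[OF zero_less_one]
  proof (eventually_elim)
    case (elim r)
    then show ?case
      using covering_number_ge_1[OF E, of r] by (simp add: zero_le_divide_iff)
  qed
qed

lemma lower_box_dim_le_upper: "lower_box_dim E \<le> upper_box_dim E"
  unfolding lower_box_dim_def upper_box_dim_def
  by (rule Liminf_le_Limsup) simp

lemma box_dim_mono:
  fixes E :: "'a::heine_borel set"
  assumes "bounded F" "E \<noteq> {}" "E \<subseteq> F"
  shows "lower_box_dim E \<le> lower_box_dim F" "upper_box_dim E \<le> upper_box_dim F"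
proof -
  have "eventually (\<lambda>r. ereal (ln (real (covering_number r E)) / ln (1 / r))
          \<le> ereal (ln (real (covering_number r F)) / ln (1 / r))) (at_right 0)"
    using eventually_at_right_real[OF zero_less_one]
  proof eventually_elim
    case (elim r)
    have "1 \<le> covering_number r E" "covering_number r E \<le> covering_number r F"
      using elim assms covering_number_ge_1[of E r] bounded_subset[of F E] covering_number_mono[of F E r] by auto
    then show ?case using elim by (auto intro!: divide_right_mono)
  qed
  then show "lower_box_dim E \<le> lower_box_dim F" "upper_box_dim E \<le> upper_box_dim F"
    unfolding lower_box_dim_def upper_box_dim_def by (auto intro: Liminf_mono Limsup_mono)
qed

text \<open>The covering of the limit set uses the fixed points at every scale up to 1, so the
  asymptotic bound is extended: from \<open>b\<close> on, the count is at most its value at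
  \<open>b / 2\<close>, while \<open>R powr - t\<close> is at least 1.\<close>

lemma covering_number_powr_bound:
  fixes E :: "'a::heine_borel set"
  assumes E: "bounded E" "E \<noteq> {}" and less: "upper_box_dim E < ereal t"
  obtains A where "0 < A" "\<And>R. 0 < R \<Longrightarrow> R \<le> 1 \<Longrightarrow> real (covering_number R E) \<le> A * R powr - t"
proof -
  have "0 \<le> ereal t"
    using lower_box_dim_nonneg[OF E] lower_box_dim_le_upper[of E] less by order
  then have "0 \<le> t" by simp
  obtain b where b: "0 < b" "\<And>R. 0 < R \<Longrightarrow> R < b \<Longrightarrow> real (covering_number R E) \<le> R powr - t"
    using upper_box_dim_lessD[OF E less] unfolding eventually_at_right_0_iff by blast
  define A where "A = 1 + real (covering_number (b / 2) E)"
  have main: "real (covering_number R E) \<le> A * R powr - t" if R: "0 < R" "R \<le> 1" for R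
  proof (cases "R < b")
    case True
    then have "real (covering_number R E) \<le> 1 * R powr - t" using b(2) R by simp
    also have "\<dots> \<le> A * R powr - t" by (intro mult_right_mono) (auto simp: A_def)
    finally show ?thesis .
  next
    case False
    then have "real (covering_number R E) \<le> A * 1"
      using covering_number_antimono[OF E(1), of "b / 2" R] b(1) by (simp add: A_def)
    also have "\<dots> \<le> A * R powr - t"
      using R \<open>0 \<le> t\<close> powr_mono2'[of "- t" R 1] by (intro mult_left_mono) (auto simp: A_def)
    finally show ?thesis .
  qed
  have "0 < A" by (simp add: A_def)
  then show thesis by (rule that[OF _ main])
qed

lemma upper_box_dim_le_DIM:
  fixes E :: "'a::euclidean_space set"
  assumes "bounded E" "E \<noteq> {}"
  shows "upper_box_dim E \<le> DIM('a)"
proof -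
  obtain A where A: "\<And>r. 0 < r \<Longrightarrow> r \<le> 1 \<Longrightarrow> real (covering_number r E) \<le> A * r powr - real DIM('a)"
    using covering_number_polynomial_bound[OF assms(1)] by metis
  have "eventually (\<lambda>r. real (covering_number r E) \<le> A * r powr - real DIM('a)) (at_right 0)"
    using eventually_at_right_real[OF zero_less_one] A by (auto elim!: eventually_mono)
  from upper_box_dim_leI[OF assms this] show ?thesis by simp
qed

section \<open>Hausdorff measure and dimension\<close>

text \<open>The radii exceed the diameters to allow for sets of diameter zero.\<close>

lemma hausdorff_measure_0_cover:
  fixes E :: "'a::metric_space set"
  assumes "hausdorff_measure t E = 0" "0 < t" "0 < \<eta>"
  obtains a :: "nat \<Rightarrow> 'a" and d :: "nat \<Rightarrow> real"
  where "\<And>k. 0 < d k" "E \<subseteq> (\<Union>k. ball (a k) (d k))" "summable (\<lambda>k. d k powr t)" "(\<Sum>k. d k powr t) \<le> \<eta>"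
proof -
  have "hausdorff_premeasure 1 t E \<le> hausdorff_measure t E"
    unfolding hausdorff_measure_def by (rule SUP_upper) simp
  then have "hausdorff_premeasure 1 t E < ennreal (\<eta> / 2)"
    using assms by simp
  then obtain A :: "nat \<Rightarrow> 'a set" where A: "E \<subseteq> (\<Union>n. A n)" "\<And>n. bounded (A n)"
    and sum: "(\<Sum>n. diam_weight t (A n)) < ennreal (\<eta> / 2)"
    unfolding hausdorff_premeasure_def INF_less_iff by auto
  define g where "g n = (if A n = {} then 0 else diameter (A n) powr t)" for n
  have g0: "0 \<le> g n" for n by (simp add: g_def)
  have "diam_weight t (A n) = ennreal (g n)" for n
    using assms by (simp add: diam_weight_def g_def)
  then have sg: "(\<Sum>n. ennreal (g n)) < ennreal (\<eta> / 2)" using sum by simp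
  then have "summable g"
    by (intro summable_suminf_not_top) (use g0 in auto)
  then have g_sum: "suminf g \<le> \<eta> / 2"
    using sg g0 assms(3) suminf_nonneg[of g] by (simp add: suminf_ennreal2 ennreal_less_iff)
  \<comment> \<open>The added geometric terms have total \<open>\<eta> / 2\<close> and make every
    weight positive. The root \<open>h n powr (1 / t)\<close> then strictly exceeds the diameter of
    \<open>A n\<close>, so an open ball of this radius about any point of \<open>A n\<close>
    contains \<open>A n\<close>.\<close>
  define h where "h n = g n + \<eta> / 2 * (1 / 2) ^ Suc n" for n
  have h_pos: "g n < h n" for n using assms(3) by (simp add: h_def)
  have "h sums (suminf g + \<eta> / 2 * 1)"
    unfolding h_def by (intro sums_add sums_mult power_half_series summable_sums \<open>summable g\<close>)
  then have h_sum: "summable h" "suminf h \<le> \<eta>"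
    using g_sum by (auto simp: sums_iff)
  define d where "d n = h n powr (1 / t)" for n
  have h0: "0 < h n" for n using g0[of n] h_pos[of n] by linarith
  have d_powr: "d n powr t = h n" for n
    using assms(2) h0[of n] by (simp add: d_def powr_powr)
  define a where "a n = (SOME x. A n = {} \<or> x \<in> A n)" for n
  have a: "A n \<noteq> {} \<Longrightarrow> a n \<in> A n" for n
    unfolding a_def by (metis (mono_tags, lifting) all_not_in_conv someI_ex)
  have "A n \<subseteq> ball (a n) (d n)" for n
  proof
    fix y assume y: "y \<in> A n"
    then have "g n = diameter (A n) powr t" by (auto simp: g_def)
    then have "diameter (A n) = g n powr (1 / t)"
      using assms(2) diameter_ge_0[OF A(2)] by (simp add: powr_powr)
    also have "\<dots> < d n"
      unfolding d_def using g0 h_pos assms(2) by (intro powr_less_mono2) auto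
    finally show "y \<in> ball (a n) (d n)"
      using diameter_bounded_bound[OF A(2), of "a n" n y] a y by fastforce
  qed
  then have "E \<subseteq> (\<Union>k. ball (a k) (d k))"
    using A(1) by fastforce
  moreover have "0 < d k" for k using h0[of k] by (simp add: d_def)
  ultimately show thesis
    using that[of d a] h_sum by (simp add: d_powr)
qed

text \<open>For sets of diameter at most 1 the weight decreases in the exponent. Restricting to such
  covers is harmless, since the premeasures with exponent \<open>s\<close> vanish at every positive
  scale.\<close>

lemma hausdorff_measure_0_mono:
  fixes E :: "'a::metric_space set"
  assumes "hausdorff_measure s E = 0" "0 \<le> s" "s < t"
  shows "hausdorff_measure t E = 0"
proof -
  have pre0: "hausdorff_premeasure \<delta> s E = 0" if "0 < \<delta>" for \<delta>
  proof -
    have "hausdorff_premeasure \<delta> s E \<le> hausdorff_measure s E"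
      unfolding hausdorff_measure_def by (rule SUP_upper) (use that in simp)
    then show ?thesis using assms(1) by simp
  qed
  have "hausdorff_premeasure \<delta> t E \<le> hausdorff_premeasure (min \<delta> 1) s E" for \<delta>
    unfolding hausdorff_premeasure_def
  proof (rule INF_mono)
    fix A :: "nat \<Rightarrow> 'a set"
    assume "A \<in> {A. E \<subseteq> (\<Union>n. A n) \<and> (\<forall>n. bounded (A n) \<and> diameter (A n) \<le> min \<delta> 1)}"
    then have A: "E \<subseteq> (\<Union>n. A n)" "\<And>n. bounded (A n)" "\<And>n. diameter (A n) \<le> \<delta>" "\<And>n. diameter (A n) \<le> 1"
      by auto
    have "diam_weight t (A n) \<le> diam_weight s (A n)" for n
    proof -
      have "diameter (A n) powr t \<le> diameter (A n) powr s" if "s \<noteq> 0"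
        using A(4)[of n] diameter_ge_0[OF A(2), of n] assms(3)
        by (cases "diameter (A n) = 0") (auto intro!: powr_mono')
      moreover have "diameter (A n) powr t \<le> 1"
        using A(4)[of n] diameter_ge_0[OF A(2), of n] assms powr_mono2[of t "diameter (A n)" 1] by simp
      ultimately show ?thesis
        using assms by (auto simp: diam_weight_def ennreal_leI)
    qed
    then have "(\<Sum>n. diam_weight t (A n)) \<le> (\<Sum>n. diam_weight s (A n))"
      by (intro suminf_le) auto
    then show "\<exists>B\<in>{A. E \<subseteq> (\<Union>n. A n) \<and> (\<forall>n. bounded (A n) \<and> diameter (A n) \<le> \<delta>)}.
        (\<Sum>n. diam_weight t (B n)) \<le> (\<Sum>n. diam_weight s (A n))"
      using A by (intro bexI[of _ A]) auto
  qed
  then have "hausdorff_premeasure \<delta> t E = 0" if "0 < \<delta>" for \<delta>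
    using pre0[of "min \<delta> 1"] that by (metis le_zero_eq min_less_iff_conj zero_less_one)
  then show ?thesis
    unfolding hausdorff_measure_def by (simp add: SUP_eq_const)
qed

lemma hausdorff_dim_lessD:
  assumes "hausdorff_dim E < ereal t"
  shows "0 < t" "hausdorff_measure t E = 0"
proof -
  obtain s where s: "0 \<le> s" "hausdorff_measure s E = 0" "s < t"
    using assms unfolding hausdorff_dim_def Inf_less_iff by auto
  then show "0 < t" "hausdorff_measure t E = 0"
    using hausdorff_measure_0_mono by auto
qed

text \<open>An optimal cover by balls, padded with empty sets of weight 0 to an infinite sequence,
  is admissible for the premeasure.\<close>

lemma hausdorff_premeasure_le_covering_number:
  fixes E :: "'a::heine_borel set"
  assumes "bounded E" "0 < r" "2 * r \<le> \<delta>" "0 < s"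
  shows "hausdorff_premeasure \<delta> s E \<le> ennreal (covering_number r E * (2 * r) powr s)"
proof -
  let ?N = "covering_number r E"
  obtain C where C: "finite C" "card C = ?N" "E \<subseteq> (\<Union>x\<in>C. ball x r)"
    using covering_number_cover[OF assms(1,2)] .
  obtain f where f: "bij_betw f {..<?N} C"
    using C ex_bij_betw_nat_finite[OF C(1)] by (auto simp: atLeast0LessThan)
  define A where "A n = (if n < ?N then ball (f n) r else {})" for n
  have "dist y z \<le> 2 * r" if "dist x y < r" "dist x z < r" for x y z :: 'a
    using that dist_triangle3[of y z x] by linarith
  then have diam: "diameter (ball x r) \<le> 2 * r" for x :: 'a
    using assms(2) by (auto simp: diameter_def intro!: cSUP_least)
  have "E \<subseteq> (\<Union>n. A n)"
  proof
    fix y assume "y \<in> E"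
    then obtain x where x: "x \<in> C" "y \<in> ball x r" using C(3) by blast
    then obtain n where "n < ?N" "x = f n" using f by (auto simp: bij_betw_def)
    then have "y \<in> A n" using x by (simp add: A_def)
    then show "y \<in> (\<Union>n. A n)" by blast
  qed
  moreover have "bounded (A n)" "diameter (A n) \<le> \<delta>" for n
    using diam[of "f n"] assms by (auto simp: A_def)
  ultimately have "hausdorff_premeasure \<delta> s E \<le> (\<Sum>n. diam_weight s (A n))"
    unfolding hausdorff_premeasure_def by (intro INF_lower) auto
  also have "\<dots> = (\<Sum>n<?N. diam_weight s (A n))"
    by (rule suminf_finite) (auto simp: A_def diam_weight_def)
  also have "\<dots> \<le> (\<Sum>n<?N. ennreal ((2 * r) powr s))"
  proof (rule sum_mono)
    fix n
    show "diam_weight s (A n) \<le> ennreal ((2 * r) powr s)"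
      using diam[of "f n"] assms diameter_ge_0[of "ball (f n) r"]
      by (auto simp: A_def diam_weight_def intro!: ennreal_leI powr_mono2)
  qed
  also have "\<dots> = ennreal (?N * (2 * r) powr s)"
    by (simp add: ennreal_mult ennreal_of_nat_eq_real_of_nat)
  finally show ?thesis .
qed

text \<open>For \<open>t < s\<close> above the lower box dimension, covers by at most
  \<open>r powr - t\<close> balls exist at arbitrarily small scales; their total weight is at most a
  constant times \<open>r powr (s - t)\<close>, which tends to 0.\<close>

lemma hausdorff_dim_le_lower_box_dim:
  fixes E :: "'a::heine_borel set"
  assumes E: "bounded E" "E \<noteq> {}"
  shows "hausdorff_dim E \<le> lower_box_dim E"
proof (rule ccontr)
  assume "\<not> ?thesis"
  then obtain s where s: "lower_box_dim E < ereal s" "ereal s < hausdorff_dim E"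
    using ereal_dense2[of "lower_box_dim E" "hausdorff_dim E"] by (auto simp: not_le)
  then obtain t where t: "lower_box_dim E < ereal t" "t < s"
    using ereal_dense2[OF s(1)] by auto
  have "0 \<le> t"
    using lower_box_dim_nonneg[OF E] t(1) by (metis ereal_less_eq(5) less_imp_le order_trans)
  note fr = lower_box_dim_lessD[OF E t(1)]
  have "hausdorff_premeasure \<delta> s E \<le> 0" if \<delta>: "0 < \<delta>" for \<delta>
  proof (rule ennreal_le_epsilon)
    fix e :: real assume e: "0 < e"
    have "eventually (\<lambda>r. 2 * r \<le> \<delta> \<and> 0 < r) (at_right 0)"
      using \<delta> by (auto simp: eventually_at_right_0_iff intro!: exI[of _ "\<delta> / 2"])
    moreover have "eventually (\<lambda>r. 2 powr s / e * r powr - t \<le> r powr - s) (at_right 0)"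
      using t(2) by (rule eventually_const_mult_powr_le)
    ultimately have "eventually (\<lambda>r. (2 * r \<le> \<delta> \<and> 0 < r) \<and> 2 powr s / e * r powr - t \<le> r powr - s) (at_right 0)"
      by (rule eventually_conj)
    then obtain r where r: "2 * r \<le> \<delta>" "0 < r" "2 powr s / e * r powr - t \<le> r powr - s"
      "real (covering_number r E) \<le> r powr - t"
      using frequently_ex[OF frequently_eventually_frequently[OF fr]] by blast
    have "covering_number r E * (2 * r) powr s \<le> r powr - t * (2 powr s * r powr s)"
      using r by (simp add: powr_mult)
    also have "\<dots> \<le> e"
      using r e by (simp add: powr_minus field_simps)
    finally have "ennreal (covering_number r E * (2 * r) powr s) \<le> ennreal e"
      by (rule ennreal_leI)
    moreover have "hausdorff_premeasure \<delta> s E \<le> ennreal (covering_number r E * (2 * r) powr s)"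
      using r t \<open>0 \<le> t\<close> by (intro hausdorff_premeasure_le_covering_number E) auto
    ultimately show "hausdorff_premeasure \<delta> s E \<le> 0 + ennreal e" by simp
  qed
  then have "hausdorff_measure s E = 0"
    unfolding hausdorff_measure_def by (intro SUP_eq_const) (auto simp: le_zero_eq)
  then have "hausdorff_dim E \<le> ereal s"
    unfolding hausdorff_dim_def using t \<open>0 \<le> t\<close> by (intro Inf_lower) auto
  then show False using s(2) by simp
qed

section \<open>Conformal maps\<close>

text \<open>The conformal factor: where the derivative is \<open>a\<close> times an orthogonal map
  with \<open>a\<close> nonnegative, this is \<open>a\<close>. The form through the Jacobian matches
  the bounded distortion assumption.\<close>

abbreviation stretch :: "(real^'n \<Rightarrow> real^'n) \<Rightarrow> real^'n \<Rightarrow> real" where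
  "stretch f x \<equiv> spectral_norm (jacobian f (at x))"

lemma stretch_eq:
  fixes f :: "real^'n \<Rightarrow> real^'n"
  assumes der: "(f has_derivative (\<lambda>h. a *\<^sub>R Q h)) (at x)" and Q: "orthogonal_transformation Q" and "0 \<le> a"
  shows "stretch f x = a"
proof -
  have jac: "(*v) (jacobian f (at x)) = (\<lambda>h. a *\<^sub>R Q h)"
    using der jacobian_works[of f "at x"] has_derivative_unique[OF _ der]
    unfolding differentiable_def by blast
  have norm: "norm (a *\<^sub>R Q h) = a * norm h" for h
    using assms(3) orthogonal_transformation_norm[OF Q] by simp
  have "onorm (\<lambda>h. a *\<^sub>R Q h) \<le> a"
    by (rule onorm_le) (simp only: norm)
  moreover obtain e :: "real^'n" where "norm e = 1"
    using vector_choose_size[of 1] by auto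
  then have "a \<le> onorm (\<lambda>h. a *\<^sub>R Q h)"
    using onorm[OF has_derivative_bounded_linear[OF der], of e] unfolding norm by simp
  ultimately show ?thesis
    unfolding spectral_norm_def jac by simp
qed

lemma conformal_onE:
  assumes "conformal_on f V" "x \<in> V"
  obtains Q where "orthogonal_transformation Q" "0 < stretch f x"
    "(f has_derivative (\<lambda>h. stretch f x *\<^sub>R Q h)) (at x)"
proof -
  obtain a Q where *: "a > 0" "orthogonal_transformation Q" "(f has_derivative (\<lambda>h. a *\<^sub>R Q h)) (at x)"
    using assms unfolding conformal_on_def by blast
  then have "stretch f x = a"
    by (intro stretch_eq) auto
  with * show thesis using that by blast
qed

lemma conformal_on_continuous_on:
  assumes "conformal_on f V"
  shows "continuous_on V f"
proof (rule differentiable_imp_continuous_on)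
  show "f differentiable_on V"
    unfolding differentiable_on_def
    by (metis assms conformal_onE differentiableI differentiable_at_withinI)
qed

lemma conformal_on_id: "conformal_on id V"
  and stretch_id: "stretch id x = 1"
proof -
  have *: "(id has_derivative (\<lambda>h. 1 *\<^sub>R id h)) (at x)" for x :: "real^'n"
    by (simp add: id_def)
  have Q: "orthogonal_transformation (id :: real^'n \<Rightarrow> real^'n)"
    by (simp add: id_def)
  show "conformal_on (id :: real^'n \<Rightarrow> real^'n) V" for V
    unfolding conformal_on_def using * Q zero_less_one by blast
  show "stretch id x = 1" for x :: "real^'n"
    by (rule stretch_eq[OF * Q]) simp
qed

text \<open>Orthogonal maps compose to orthogonal maps, so for conformal maps the norm of a product
  of derivatives is exactly the product of the norms.\<close>

lemma conformal_on_compose: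
  assumes f: "conformal_on f V" and g: "conformal_on g V" and "g ` V \<subseteq> V"
  shows "conformal_on (f \<circ> g) V"
    and stretch_compose: "x \<in> V \<Longrightarrow> stretch (f \<circ> g) x = stretch f (g x) * stretch g x"
proof -
  have "\<exists>Q. orthogonal_transformation Q \<and> 0 < stretch f (g x) * stretch g x \<and>
      (f \<circ> g has_derivative (\<lambda>h. (stretch f (g x) * stretch g x) *\<^sub>R Q h)) (at x)"
    if x: "x \<in> V" for x
  proof -
    have "g x \<in> V" using assms(3) x by blast
    obtain P where P: "orthogonal_transformation P" "0 < stretch f (g x)"
      "(f has_derivative (\<lambda>h. stretch f (g x) *\<^sub>R P h)) (at (g x))"
      using conformal_onE[OF f \<open>g x \<in> V\<close>] .
    obtain Q where Q: "orthogonal_transformation Q" "0 < stretch g x"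
      "(g has_derivative (\<lambda>h. stretch g x *\<^sub>R Q h)) (at x)"
      using conformal_onE[OF g x] .
    have "(f \<circ> g has_derivative (\<lambda>h. stretch f (g x) *\<^sub>R P h) \<circ> (\<lambda>h. stretch g x *\<^sub>R Q h)) (at x)"
      using Q(3) P(3) by (rule diff_chain_at)
    moreover have "(\<lambda>h. stretch f (g x) *\<^sub>R P h) \<circ> (\<lambda>h. stretch g x *\<^sub>R Q h)
        = (\<lambda>h. (stretch f (g x) * stretch g x) *\<^sub>R (P \<circ> Q) h)"
      using orthogonal_transformation_linear[OF P(1)] by (auto simp: linear_scale)
    ultimately show ?thesis
      using orthogonal_transformation_compose[OF P(1) Q(1)] P(2) Q(2) by (metis mult_pos_pos)
  qed
  note * = this
  show "conformal_on (f \<circ> g) V"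
    unfolding conformal_on_def using * by blast
  show "stretch (f \<circ> g) x = stretch f (g x) * stretch g x" if "x \<in> V" for x
    using *[OF that] stretch_eq less_imp_le by blast
qed

lemma conformal_on_Lipschitz:
  fixes f :: "real^'n \<Rightarrow> real^'n"
  assumes "conformal_on f V" "convex C" "C \<subseteq> V" "\<And>z. z \<in> C \<Longrightarrow> stretch f z \<le> B" "x \<in> C" "y \<in> C"
  shows "dist (f x) (f y) \<le> B * dist x y"
proof -
  have "norm (f x - f y) \<le> B * norm (x - y)"
  proof (rule differentiable_bound[where f' = "\<lambda>z. (*v) (jacobian f (at z))", OF assms(2)])
    fix z assume z: "z \<in> C"
    then have "z \<in> V" using assms(3) by blast
    then have d: "f differentiable (at z)"
      using conformal_onE[OF assms(1), of z] differentiableI by metis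
    then show "(f has_derivative (*v) (jacobian f (at z))) (at z within C)"
      by (simp add: jacobian_works has_derivative_at_withinI)
    show "onorm ((*v) (jacobian f (at z))) \<le> B"
      using assms(4)[OF z] by (simp add: spectral_norm_def)
  qed (use assms in auto)
  then show ?thesis by (simp add: dist_norm)
qed

text \<open>Compares \<open>f\<close> with its linearization along one short vector; as
  \<open>x\<close> is interior, the displaced point stays in \<open>X\<close>, where the Lipschitz
  bound holds. This turns contraction on \<open>X\<close> into a bound on derivatives.\<close>

lemma stretch_le_of_Lipschitz:
  fixes f :: "real^'n \<Rightarrow> real^'n"
  assumes "conformal_on f V" "x \<in> V" "x \<in> interior X" "\<And>y. y \<in> X \<Longrightarrow> dist (f x) (f y) \<le> B * dist x y"
  shows "stretch f x \<le> B"
proof (rule field_le_epsilon)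
  fix e :: real assume "0 < e"
  obtain Q where Q: "orthogonal_transformation Q" "(f has_derivative (\<lambda>h. stretch f x *\<^sub>R Q h)) (at x)" "0 < stretch f x"
    using conformal_onE[OF assms(1,2)] by metis
  then obtain d where d: "0 < d" "\<And>y. norm (y - x) < d \<Longrightarrow>
      norm (f y - f x - stretch f x *\<^sub>R Q (y - x)) \<le> e * norm (y - x)"
    using \<open>0 < e\<close> unfolding has_derivative_at_alt by blast
  obtain d' where d': "0 < d'" "ball x d' \<subseteq> X"
    using assms(3) mem_interior by blast
  obtain h :: "real^'n" where h: "norm h = min d d' / 2"
    using vector_choose_size[of "min d d' / 2"] d(1) d'(1) by auto
  then have hd: "norm h < d" "norm h < d'" "0 < norm h"
    using d(1) d'(1) by auto
  have "stretch f x * norm h = norm (stretch f x *\<^sub>R Q h)"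
    using Q orthogonal_transformation_norm[OF Q(1)] by simp
  also have "\<dots> \<le> norm (f (x + h) - f x) + norm (f (x + h) - f x - stretch f x *\<^sub>R Q h)"
    by (smt (verit) norm_triangle_ineq3 norm_minus_commute)
  also have "norm (f (x + h) - f x - stretch f x *\<^sub>R Q h) \<le> e * norm h"
    using d(2)[of "x + h"] hd by simp
  also have "norm (f (x + h) - f x) \<le> B * norm h"
  proof -
    have "x + h \<in> X" using d' hd by (auto simp: dist_norm)
    from assms(4)[OF this] show ?thesis by (simp add: dist_norm norm_minus_commute)
  qed
  finally have "stretch f x * norm h \<le> (B + e) * norm h" by (simp add: algebra_simps)
  then show "stretch f x \<le> B + e" using hd by (simp add: mult_le_cancel_right)
qed

text \<open>The inverse branch is Lipschitz on every ball inside the image, so a ball about \<open>f x\<close> can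
  only leave the image through points whose preimages reach the boundary of the domain ball.\<close>

lemma conformal_image_contains_ball:
  fixes f :: "real^'n \<Rightarrow> real^'n"
  assumes f: "conformal_on f (ball x \<delta>)" and inj: "inj_on f (ball x \<delta>)"
    and m: "0 < m" "\<And>y. y \<in> ball x \<delta> \<Longrightarrow> m \<le> stretch f y" and "0 < \<delta>"
  shows "ball (f x) (m * \<delta>) \<subseteq> f ` ball x \<delta>"
proof (rule ccontr)
  let ?B = "ball x \<delta>"
  define W where "W = f ` ?B"
  assume notsub: "\<not> ball (f x) (m * \<delta>) \<subseteq> f ` ?B"
  have contf: "continuous_on ?B f" using conformal_on_continuous_on[OF f] .
  have openW: "open W"
    unfolding W_def by (rule invariance_of_domain[OF contf open_ball inj])
  then have "closed (- W)" by (rule closed_Compl)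
  moreover have "- W \<noteq> {}" using notsub unfolding W_def by blast
  \<comment> \<open>\<open>z\<close> is a point of the complement of the image nearest to
    \<open>f x\<close>. The open ball of radius \<open>s\<close> about \<open>f x\<close> therefore
    lies in the image, and the contradiction will be that \<open>z\<close> does too.\<close>
  ultimately obtain z where z: "z \<notin> W" "infdist (f x) (- W) = dist (f x) z"
    using infdist_attains_inf[of "- W" "f x"] by blast
  define s where "s = dist (f x) z"
  have near: "q \<in> W" if "dist (f x) q < s" for q
  proof (rule ccontr)
    assume "q \<notin> W"
    then have "infdist (f x) (- W) \<le> dist (f x) q" by (intro infdist_le) simp
    with that z(2) show False by (simp add: s_def)
  qed
  have "s < m * \<delta>"
  proof -
    obtain q where "dist (f x) q < m * \<delta>" "q \<notin> W" using notsub unfolding W_def mem_ball[symmetric] by blast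
    then show ?thesis using near[of q] by linarith
  qed
  have "f x \<in> W" using \<open>0 < \<delta>\<close> by (simp add: W_def)
  then have "0 < s" using z(1) unfolding s_def by auto
  define g where "g = inv_into ?B f"
  have gf: "g (f y) = y" if "y \<in> ?B" for y
    using that inj by (simp add: g_def)
  have g_lip: "dist (g p) (g q) \<le> (1 / m) * dist p q" if "p \<in> ball (f x) s" "q \<in> ball (f x) s" for p q
  proof -
    have "norm (g p - g q) \<le> 1 / m * norm (p - q)"
    proof (rule differentiable_bound[of "ball (f x) s" g "\<lambda>p. frechet_derivative g (at p)"])
      fix p assume "p \<in> ball (f x) s"
      then obtain y where y: "y \<in> ?B" "p = f y" using near[of p] by (auto simp: W_def)
      obtain Q where Q: "orthogonal_transformation Q" "0 < stretch f y"
        "(f has_derivative (\<lambda>h. stretch f y *\<^sub>R Q h)) (at y)"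
        using conformal_onE[OF f y(1)] .
      let ?g' = "\<lambda>h. (1 / stretch f y) *\<^sub>R inv Q h"
      have invQ: "orthogonal_transformation (inv Q)"
        using Q(1) by (rule orthogonal_transformation_inv)
      have QQ: "Q (inv Q h) = h" for h
        using orthogonal_transformation_surj[OF Q(1)] by (simp add: surj_f_inv_f)
      have "(\<lambda>h. stretch f y *\<^sub>R Q h) \<circ> ?g' = id"
        using Q(2) by (auto simp: fun_eq_iff QQ linear_scale[OF orthogonal_transformation_linear[OF Q(1)]])
      \<comment> \<open>The inverse function theorem gives the derivative of the inverse branch, an
        orthogonal map divided by the conformal factor, hence of norm at most
        \<open>1 / m\<close>.\<close>
      then have der: "(g has_derivative ?g') (at (f y))"
        using has_derivative_inverse_strong[OF open_ball y(1) contf gf Q(3)] by blast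
      then have "frechet_derivative g (at p) = ?g'"
        using frechet_derivative_at[OF der] y(2) by simp
      moreover have "onorm ?g' \<le> 1 / m"
      proof (rule onorm_le)
        fix h
        have "norm (?g' h) = (1 / stretch f y) * norm h"
          using Q(2) orthogonal_transformation_norm[OF invQ] by simp
        also have "\<dots> \<le> (1 / m) * norm h"
          using m(1) m(2)[OF y(1)] by (intro mult_right_mono divide_left_mono) auto
        finally show "norm (?g' h) \<le> 1 / m * norm h" .
      qed
      ultimately show "onorm (frechet_derivative g (at p)) \<le> 1 / m"
        and "(g has_derivative frechet_derivative g (at p)) (at p within ball (f x) s)"
        using der y(2) by (auto intro: has_derivative_at_withinI)
    qed (use that in auto)
    then show ?thesis by (simp add: dist_norm)
  qed
  have "s / m < \<delta>" using \<open>s < m * \<delta>\<close> m(1) by (simp add: field_simps)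
  then have cb: "cball x (s / m) \<subseteq> ?B" by auto
  \<comment> \<open>The Lipschitz bound pulls the ball back into a closed ball inside the domain.
    The image of that closed ball is compact, so it contains the closure of the ball and with it
    \<open>z\<close>.\<close>
  have "ball (f x) s \<subseteq> f ` cball x (s / m)"
  proof
    fix p assume p: "p \<in> ball (f x) s"
    then obtain y where y: "y \<in> ?B" "p = f y" using near[of p] by (auto simp: W_def)
    have "dist (g (f x)) (g p) \<le> 1 / m * dist (f x) p"
      using p \<open>0 < s\<close> by (intro g_lip) auto
    also have "\<dots> \<le> 1 / m * s" using p m(1) by (intro mult_left_mono) auto
    finally have "dist x y \<le> s / m" using gf y \<open>0 < \<delta>\<close> by simp
    then show "p \<in> f ` cball x (s / m)" using y(2) by simp
  qed
  moreover have "compact (f ` cball x (s / m))"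
    using continuous_on_subset[OF contf cb] by (intro compact_continuous_image compact_cball)
  ultimately have "closure (ball (f x) s) \<subseteq> f ` cball x (s / m)"
    by (intro closure_minimal compact_imp_closed)
  then have "cball (f x) s \<subseteq> f ` cball x (s / m)" using \<open>0 < s\<close> by simp
  moreover have "z \<in> cball (f x) s" by (simp add: s_def)
  ultimately show False using cb z(1) unfolding W_def by blast
qed

text \<open>The distances from \<open>p\<close> to points of the connected set fill
  \<open>{0..dist p q}\<close>, and each covering piece accounts for a part of length at most
  \<open>2 * \<eta>\<close>. This makes local Lipschitz bounds global on a set that need not be
  convex.\<close>

lemma connected_dist_le:
  fixes S :: "'a::metric_space set"
  assumes "connected S" "finite A" "S \<subseteq> (\<Union>k\<in>A. U k)"
    and small: "\<And>k x y. k \<in> A \<Longrightarrow> x \<in> U k \<Longrightarrow> y \<in> U k \<Longrightarrow> dist x y \<le> \<eta>"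
    and p: "p \<in> S" and q: "q \<in> S" and "0 \<le> \<eta>"
  shows "dist p q \<le> real (card A) * (2 * \<eta>)"
proof -
  define u where "u k = (SOME x. x \<in> U k)" for k
  define J where "J k = {dist p (u k) - \<eta> .. dist p (u k) + \<eta>}" for k
  have "connected (dist p ` S)"
    by (intro connected_continuous_image continuous_intros assms)
  moreover have "0 \<in> dist p ` S" "dist p q \<in> dist p ` S"
    using p q by (auto intro: rev_image_eqI)
  ultimately have "{0..dist p q} \<subseteq> dist p ` S"
    by (metis connected_contains_Icc)
  also have "\<dots> \<subseteq> (\<Union>k\<in>A. J k)"
  proof
    fix t assume "t \<in> dist p ` S"
    then obtain x k where x: "t = dist p x" "k \<in> A" "x \<in> U k" using assms(3) by blast
    then have "u k \<in> U k" unfolding u_def by (metis someI)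
    with x small have "dist x (u k) \<le> \<eta>" by blast
    then have "t \<in> J k"
      unfolding J_def x(1) using dist_triangle[of p x "u k"] dist_triangle[of p "u k" x]
      by (simp add: dist_commute)
    then show "t \<in> (\<Union>k\<in>A. J k)" using x(2) by blast
  qed
  finally have sub: "{0..dist p q} \<subseteq> (\<Union>k\<in>A. J k)" .
  have "dist p q = measure lborel {0..dist p q}" by simp
  also have "\<dots> \<le> measure lborel (\<Union>k\<in>A. J k)"
    by (rule measure_mono_fmeasurable[OF sub]) (use assms(2) in \<open>auto simp: J_def intro!: fmeasurable_compact fmeasurable.finite_UN\<close>)
  also have "\<dots> \<le> (\<Sum>k\<in>A. measure lborel (J k))"
    by (rule measure_UNION_le) (use assms(2) in \<open>auto simp: J_def\<close>)
  also have "\<dots> = real (card A) * (2 * \<eta>)"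
    using assms(7) by (simp add: J_def)
  finally show ?thesis .
qed

section \<open>Ratios of words\<close>

lemma word_map_append: "word_map T (v @ w) = word_map T v \<circ> word_map T w"
  by (induction v) (auto simp: o_assoc)

text \<open>Fixes the open set \<open>V\<close>, the extended maps \<open>T\<close> and the
  constants \<open>c\<close> and \<open>K\<close>, which a CIFS provides only existentially. Working
  with the extensions allows words to be differentiated at all points of \<open>X\<close>.\<close>

locale conformal_system =
  fixes X V :: "(real^'d) set" and I :: "'i set" and T :: "'i \<Rightarrow> real^'d \<Rightarrow> real^'d"
    and c K :: real
  assumes compact_X: "compact X"
    and connected_X: "connected X"
    and interior_nonempty: "interior X \<noteq> {}"
    and index_nonempty: "I \<noteq> {}"
    and open_V: "open V"
    and X_subset_V: "X \<subseteq> V"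
    and maps_X: "\<And>i. i \<in> I \<Longrightarrow> T i ` X \<subseteq> X"
    and maps_V: "\<And>i. i \<in> I \<Longrightarrow> T i ` V \<subseteq> V"
    and inj_X: "\<And>i. i \<in> I \<Longrightarrow> inj_on (T i) X"
    and conformal: "\<And>i. i \<in> I \<Longrightarrow> conformal_on (T i) V"
    and c: "0 < c" "c < 1"
    and contraction: "\<And>i x y. i \<in> I \<Longrightarrow> x \<in> X \<Longrightarrow> y \<in> X \<Longrightarrow> dist (T i x) (T i y) \<le> c * dist x y"
    and K: "1 \<le> K"
    and distortion: "\<And>w x y. w \<in> lists I \<Longrightarrow> x \<in> V \<Longrightarrow> y \<in> V \<Longrightarrow>
        stretch (word_map T w) x \<le> K * stretch (word_map T w) y"
    and interior_invariant: "\<And>i. i \<in> I \<Longrightarrow> T i ` interior X \<subseteq> interior X"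
    and interior_disjoint: "\<And>i j. i \<in> I \<Longrightarrow> j \<in> I \<Longrightarrow> i \<noteq> j \<Longrightarrow>
        T i ` interior X \<inter> T j ` interior X = {}"
begin

abbreviation "cyl \<equiv> word_map T"

definition base_point :: "real^'d" where
  "base_point = (SOME x. x \<in> interior X)"

text \<open>The size of the cylinder of \<open>w\<close> up to constants; by bounded distortion
  another reference point changes it by at most the factor \<open>K\<close>. An interior point is
  used so that contraction on \<open>X\<close> bounds the derivative there and cylinders contain
  balls about its images.\<close>

definition ratio :: "'i list \<Rightarrow> real" where
  "ratio w = stretch (cyl w) base_point"

lemma base_point: "base_point \<in> interior X" "base_point \<in> X" "base_point \<in> V"
proof -
  show "base_point \<in> interior X"
    unfolding base_point_def using interior_nonempty by (simp add: some_in_eq)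
  then show "base_point \<in> X" "base_point \<in> V"
    using interior_subset X_subset_V by blast+
qed

lemma cyl_maps:
  assumes "w \<in> lists I"
  shows "cyl w ` X \<subseteq> X" "cyl w ` V \<subseteq> V" "cyl w ` interior X \<subseteq> interior X"
proof -
  have "cyl w ` X \<subseteq> X \<and> cyl w ` V \<subseteq> V \<and> cyl w ` interior X \<subseteq> interior X"
    using assms
  proof (induction w)
    case (Cons i w)
    then have "i \<in> I" and IH: "cyl w ` X \<subseteq> X" "cyl w ` V \<subseteq> V" "cyl w ` interior X \<subseteq> interior X"
      by auto
    then show ?case
      using image_mono[OF IH(1), of "T i"] image_mono[OF IH(2), of "T i"] image_mono[OF IH(3), of "T i"]
        maps_X[of i] maps_V[of i] interior_invariant[of i] \<open>i \<in> I\<close>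
      by (simp add: image_comp subset_trans[of _ "T i ` _"])
  qed simp
  then show "cyl w ` X \<subseteq> X" "cyl w ` V \<subseteq> V" "cyl w ` interior X \<subseteq> interior X" by auto
qed

lemma cyl_inj: "w \<in> lists I \<Longrightarrow> inj_on (cyl w) X"
proof (induction w)
  case (Cons i w)
  then have "inj_on (T i) (cyl w ` X)"
    by (intro inj_on_subset[OF inj_X cyl_maps(1)]) auto
  then show ?case
    using Cons unfolding word_map.simps by (intro comp_inj_on) auto
qed simp

lemma cyl_conformal: "w \<in> lists I \<Longrightarrow> conformal_on (cyl w) V"
proof (induction w)
  case (Cons i w)
  then show ?case
    unfolding word_map.simps by (intro conformal_on_compose conformal cyl_maps(2)) auto
qed (simp add: conformal_on_id)

lemma cyl_contraction:
  assumes "w \<in> lists I" "x \<in> X" "y \<in> X"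
  shows "dist (cyl w x) (cyl w y) \<le> c ^ length w * dist x y"
  using assms(1)
proof (induction w)
  case (Cons i w)
  then have "dist (cyl (i # w) x) (cyl (i # w) y) \<le> c * dist (cyl w x) (cyl w y)"
    using cyl_maps(1)[of w] assms by (auto intro!: contraction)
  also have "\<dots> \<le> c * (c ^ length w * dist x y)"
    using Cons c by (intro mult_left_mono) auto
  finally show ?case by simp
qed simp

text \<open>A common first letter can be stripped because each map is injective on \<open>X\<close>;
  at the first differing letters the open set condition separates the images.\<close>

lemma cyl_disjoint:
  assumes "v \<in> lists I" "w \<in> lists I" "\<not> prefix v w" "\<not> prefix w v"
  shows "cyl v ` interior X \<inter> cyl w ` interior X = {}"
  using assms
proof (induction v arbitrary: w)
  case (Cons i v)
  then obtain j w' where w: "w = j # w'" by (cases w) auto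
  have sub: "cyl v ` interior X \<subseteq> interior X" "cyl w' ` interior X \<subseteq> interior X"
    using Cons w cyl_maps(3) by auto
  show ?case
  proof (cases "i = j")
    case True
    then have "cyl v ` interior X \<inter> cyl w' ` interior X = {}"
      using Cons w by auto
    moreover have "inj_on (T i) (interior X)"
      using Cons.hyps by (intro inj_on_subset[OF inj_X interior_subset]) simp
    ultimately have "T i ` (cyl v ` interior X) \<inter> T i ` (cyl w' ` interior X) = {}"
      using sub by (metis image_empty inj_on_image_Int)
    then show ?thesis using w True by (simp add: image_comp)
  next
    case False
    then have "T i ` interior X \<inter> T j ` interior X = {}"
      using Cons.hyps Cons.prems w by (intro interior_disjoint) auto
    then show ?thesis
      using w image_mono[OF sub(1), of "T i"] image_mono[OF sub(2), of "T j"]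
      by (simp add: image_comp[symmetric]) blast
  qed
qed simp

lemma ratio_Nil [simp]: "ratio [] = 1"
  by (simp add: ratio_def stretch_id)

lemma ratio_pos: "w \<in> lists I \<Longrightarrow> 0 < ratio w"
  unfolding ratio_def using conformal_onE[OF cyl_conformal base_point(3)] by metis

lemma stretch_le_ratio: "w \<in> lists I \<Longrightarrow> x \<in> V \<Longrightarrow> stretch (cyl w) x \<le> K * ratio w"
  unfolding ratio_def by (rule distortion[OF _ _ base_point(3)])

lemma ratio_le_stretch: "w \<in> lists I \<Longrightarrow> x \<in> V \<Longrightarrow> ratio w \<le> K * stretch (cyl w) x"
  unfolding ratio_def by (rule distortion[OF _ base_point(3)])

lemma ratio_append_eq:
  assumes "v \<in> lists I" "w \<in> lists I"
  shows "ratio (v @ w) = stretch (cyl v) (cyl w base_point) * ratio w"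
  unfolding ratio_def word_map_append
  by (rule stretch_compose[OF cyl_conformal[OF assms(1)] cyl_conformal[OF assms(2)] cyl_maps(2)[OF assms(2)] base_point(3)])

text \<open>The chain rule gives an exact product with the derivative of \<open>cyl v\<close> taken
  at \<open>cyl w base_point\<close>; distortion moves it back to \<open>base_point\<close> at the
  cost of \<open>K\<close>.\<close>

lemma ratio_append:
  assumes "v \<in> lists I" "w \<in> lists I"
  shows "ratio (v @ w) \<le> K * (ratio v * ratio w)" "ratio v * ratio w \<le> K * ratio (v @ w)"
proof -
  have "cyl w base_point \<in> V" using assms cyl_maps(2)[of w] base_point(3) by blast
  then show "ratio (v @ w) \<le> K * (ratio v * ratio w)" "ratio v * ratio w \<le> K * ratio (v @ w)"
    unfolding ratio_append_eq[OF assms] 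
    using stretch_le_ratio[OF assms(1)] ratio_le_stretch[OF assms(1)] ratio_pos[OF assms(2)]
    by (auto simp: mult.assoc[symmetric])
qed

lemma ratio_le_power: "w \<in> lists I \<Longrightarrow> ratio w \<le> c ^ length w"
  unfolding ratio_def
  using cyl_contraction base_point by (intro stretch_le_of_Lipschitz[OF cyl_conformal]) auto

lemma ratio_le_1: "w \<in> lists I \<Longrightarrow> ratio w \<le> 1"
  using ratio_le_power[of w] power_le_one[of c "length w"] c by auto

text \<open>Bounds cylinder diameters by their ratios. The mean value inequality needs convex sets,
  so it is used on small balls inside \<open>V\<close>, and connectedness of \<open>X\<close> links
  these balls.\<close>

lemma cyl_Lipschitz:
  obtains L where "1 \<le> L"
    "\<And>w x y. w \<in> lists I \<Longrightarrow> x \<in> X \<Longrightarrow> y \<in> X \<Longrightarrow> dist (cyl w x) (cyl w y) \<le> L * ratio w * dist x y"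
proof -
  obtain \<delta> where \<delta>: "0 < \<delta>" "(\<Union>x\<in>X. ball x \<delta>) \<subseteq> V"
    using compact_subset_open_imp_ball_epsilon_subset[OF compact_X open_V X_subset_V] .
  obtain C where C: "finite C" "C \<subseteq> X" "X \<subseteq> (\<Union>z\<in>C. ball z (\<delta> / 2))"
    using compactE_image[OF compact_X, of X "\<lambda>z. ball z (\<delta> / 2)"] \<delta>(1) by force
  \<comment> \<open>The first summand serves points closer than \<open>\<delta>\<close>, which lie
    in a single ball. The second serves the others: linking over \<open>C\<close> gives a multiple
    of \<open>\<delta>\<close>, and here \<open>\<delta>\<close> is at most their distance.\<close>
  define L where "L = K + real (card C) * (2 * K)"
  have "dist (cyl w x) (cyl w y) \<le> L * ratio w * dist x y"
    if w: "w \<in> lists I" and x: "x \<in> X" and y: "y \<in> X" for w x y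
  proof -
    note r = ratio_pos[OF w]
    have local: "dist (cyl w p) (cyl w q) \<le> K * ratio w * dist p q"
      if "z \<in> X" "p \<in> ball z \<delta>" "q \<in> ball z \<delta>" for z p q
    proof -
      have sub: "ball z \<delta> \<subseteq> V" using that(1) \<delta>(2) by blast
      show ?thesis
        by (rule conformal_on_Lipschitz[OF cyl_conformal[OF w] convex_ball sub])
          (use that sub stretch_le_ratio[OF w] in blast)+
    qed
    show ?thesis
    proof (cases "dist x y < \<delta>")
      case True
      then have "dist (cyl w x) (cyl w y) \<le> K * ratio w * dist x y"
        using local[of x x y] x \<delta>(1) by simp
      also have "\<dots> \<le> L * ratio w * dist x y"
        using r K by (intro mult_right_mono) (auto simp: L_def)
      finally show ?thesis .
    next
      case False
      have "dist (cyl w x) (cyl w y) \<le> real (card C) * (2 * (K * ratio w * \<delta>))"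
      proof (rule connected_dist_le[where S = "cyl w ` X" and U = "\<lambda>z. cyl w ` ball z (\<delta> / 2)"])
        show "connected (cyl w ` X)"
          using conformal_on_continuous_on[OF cyl_conformal[OF w]] X_subset_V connected_X
          by (metis connected_continuous_image continuous_on_subset)
        show "cyl w ` X \<subseteq> (\<Union>z\<in>C. cyl w ` ball z (\<delta> / 2))" using C(3) by blast
        fix z p q assume z: "z \<in> C" and "p \<in> cyl w ` ball z (\<delta> / 2)" "q \<in> cyl w ` ball z (\<delta> / 2)"
        then obtain p' q' where *: "p = cyl w p'" "dist z p' < \<delta> / 2" "q = cyl w q'" "dist z q' < \<delta> / 2" by auto
        then have "dist p q \<le> K * ratio w * dist p' q'"
          using local[of z p' q'] z C(2) \<delta>(1) by auto
        also have "dist p' q' \<le> \<delta>"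
          using * dist_triangle3[of p' q' z] by linarith
        finally show "dist p q \<le> K * ratio w * \<delta>" using r K by simp
      qed (use C x y r K \<delta> in auto)
      also have "\<dots> = real (card C) * (2 * K) * ratio w * \<delta>" by simp
      also have "\<dots> \<le> L * ratio w * dist x y"
        using r K False \<delta>(1) by (intro mult_mono) (auto simp: L_def)
      finally show ?thesis .
    qed
  qed
  moreover have "1 \<le> L" using K by (simp add: L_def add_increasing2)
  ultimately show thesis using that by blast
qed

text \<open>Distortion bounds the derivative of \<open>cyl w\<close> below by
  \<open>ratio w / K\<close> on one fixed ball in the interior of \<open>X\<close>, so the ball
  lemma for conformal images applies uniformly in \<open>w\<close>.\<close>

lemma cyl_contains_ball:
  obtains \<kappa> where "0 < \<kappa>" "\<And>w. w \<in> lists I \<Longrightarrow> ball (cyl w base_point) (\<kappa> * ratio w) \<subseteq> cyl w ` interior X"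
proof -
  obtain \<delta> where \<delta>: "0 < \<delta>" "ball base_point \<delta> \<subseteq> interior X"
    using base_point(1) open_contains_ball_eq[OF open_interior] by blast
  have "ball (cyl w base_point) (\<delta> / K * ratio w) \<subseteq> cyl w ` interior X" if w: "w \<in> lists I" for w
  proof -
    have sub: "ball base_point \<delta> \<subseteq> X" "ball base_point \<delta> \<subseteq> V"
      using \<delta>(2) interior_subset X_subset_V by blast+
    have "ball (cyl w base_point) (ratio w / K * \<delta>) \<subseteq> cyl w ` ball base_point \<delta>"
    proof (rule conformal_image_contains_ball)
      show "conformal_on (cyl w) (ball base_point \<delta>)"
        using cyl_conformal[OF w] sub(2) unfolding conformal_on_def by blast
      show "inj_on (cyl w) (ball base_point \<delta>)"
        using cyl_inj[OF w] sub(1) inj_on_subset by blast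
      show "ratio w / K \<le> stretch (cyl w) y" if "y \<in> ball base_point \<delta>" for y
        using ratio_le_stretch[OF w, of y] sub(2) that K by (auto simp: field_simps)
    qed (use ratio_pos[OF w] K \<delta> in auto)
    then show ?thesis using \<delta>(2) by (auto simp: mult.commute)
  qed
  moreover have "0 < \<delta> / K" using \<delta> K by simp
  ultimately show thesis using that by blast
qed

end

section \<open>Sums over words\<close>

definition words :: "'i set \<Rightarrow> nat \<Rightarrow> 'i list set" where
  "words J n = {w. set w \<subseteq> J \<and> length w = n}"

lemma finite_words: "finite J \<Longrightarrow> finite (words J n)"
  unfolding words_def by (rule finite_lists_length_eq)

lemma words_0 [simp]: "words J 0 = {[]}"
  by (auto simp: words_def)

lemma words_subset_lists: "J \<subseteq> I \<Longrightarrow> words J n \<subseteq> lists I"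
  by (auto simp: words_def)

lemma words_append: "v \<in> words J a \<Longrightarrow> u \<in> words J b \<Longrightarrow> v @ u \<in> words J (a + b)"
  by (auto simp: words_def)

lemma words_take: "w \<in> words J n \<Longrightarrow> j \<le> n \<Longrightarrow> take j w \<in> words J j"
  using set_take_subset[of j w] by (auto simp: words_def)

lemma words_drop: "w \<in> words J n \<Longrightarrow> drop j w \<in> words J (n - j)"
  using set_drop_subset[of j w] by (auto simp: words_def)

lemma words_nonempty: "J \<noteq> {} \<Longrightarrow> words J n \<noteq> {}"
proof -
  assume "J \<noteq> {}"
  then obtain i where "i \<in> J" by blast
  then have "replicate n i \<in> words J n" by (auto simp: words_def)
  then show ?thesis by blast
qed

lemma sum_words_extensions:
  assumes "v \<in> words J j" "j \<le> m"
  shows "sum f {w \<in> words J m. take j w = v} = (\<Sum>u\<in>words J (m - j). f (v @ u))"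
proof -
  have "{w \<in> words J m. take j w = v} = (@) v ` words J (m - j)"
  proof (intro subset_antisym subsetI)
    fix w assume "w \<in> {w \<in> words J m. take j w = v}"
    then have "w = v @ drop j w" "drop j w \<in> words J (m - j)"
      using words_drop[of w J m j] by auto
    then show "w \<in> (@) v ` words J (m - j)" by blast
  next
    fix w assume "w \<in> (@) v ` words J (m - j)"
    then show "w \<in> {w \<in> words J m. take j w = v}"
      using assms words_append[of v J j _ "m - j"] by (auto simp: words_def)
  qed
  then show ?thesis by (simp add: sum.reindex inj_on_def)
qed

lemma sum_words_append:
  assumes "finite J"
  shows "sum f (words J (a + b)) = (\<Sum>v\<in>words J a. \<Sum>u\<in>words J b. f (v @ u))"
proof -
  have "take a ` words J (a + b) \<subseteq> words J a" by (auto intro: words_take)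
  then have "sum f (words J (a + b)) = (\<Sum>v\<in>words J a. sum f {w \<in> words J (a + b). take a w = v})"
    by (intro sum.group[symmetric] finite_words assms)
  also have "\<dots> = (\<Sum>v\<in>words J a. \<Sum>u\<in>words J b. f (v @ u))"
    by (rule sum.cong[OF refl]) (simp add: sum_words_extensions)
  finally show ?thesis .
qed

context conformal_system
begin

abbreviation "lim_set \<equiv> limit_set X I T"

text \<open>The partition function at level \<open>n\<close> of the subsystem with alphabet
  \<open>J\<close>. It is used for finite \<open>J\<close>, where levels are finite and one-letter
  ratios are bounded away from 0.\<close>

definition word_sum :: "'i set \<Rightarrow> real \<Rightarrow> nat \<Rightarrow> real" where
  "word_sum J t n = (\<Sum>w\<in>words J n. ratio w powr t)"

lemma word_sum_pos:
  assumes "finite J" "J \<subseteq> I" "J \<noteq> {}"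
  shows "0 < word_sum J t n"
  unfolding word_sum_def
proof (rule sum_pos)
  show "0 < ratio w powr t" if "w \<in> words J n" for w
    using ratio_pos[of w] words_subset_lists[OF assms(2)] that by fastforce
qed (simp_all add: assms words_nonempty finite_words)

lemma word_sum_extensions_le:
  assumes J: "finite J" "J \<subseteq> I" and "0 \<le> t" "v \<in> words J j" "j \<le> m"
  shows "(\<Sum>w | w \<in> words J m \<and> take j w = v. ratio w powr t) \<le> K powr t * ratio v powr t * word_sum J t (m - j)"
proof -
  have v: "v \<in> lists I" using assms words_subset_lists[OF J(2)] by blast
  have "(\<Sum>w | w \<in> words J m \<and> take j w = v. ratio w powr t) = (\<Sum>u\<in>words J (m - j). ratio (v @ u) powr t)"
    by (rule sum_words_extensions[OF assms(4,5)])
  also have "\<dots> \<le> (\<Sum>u\<in>words J (m - j). K powr t * ratio v powr t * ratio u powr t)"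
  proof (rule sum_mono)
    fix u assume "u \<in> words J (m - j)"
    then have u: "u \<in> lists I" using words_subset_lists[OF J(2)] by blast
    then have "ratio (v @ u) powr t \<le> (K * (ratio v * ratio u)) powr t"
      using ratio_append(1)[OF v u] ratio_pos[of "v @ u"] v assms(3) by (intro powr_mono2) auto
    then show "ratio (v @ u) powr t \<le> K powr t * ratio v powr t * ratio u powr t"
      using ratio_pos[OF u] ratio_pos[OF v] K by (simp add: powr_mult)
  qed
  finally show ?thesis by (simp add: word_sum_def sum_distrib_left)
qed

text \<open>Words of length \<open>a + b\<close> are the concatenations of words of lengths
  \<open>a\<close> and \<open>b\<close>, and concatenation costs at most the factor \<open>K\<close>
  in \<open>ratio\<close>.\<close>

lemma word_sum_supermultiplicative:
  assumes J: "finite J" "J \<subseteq> I" and "0 \<le> t"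
  shows "word_sum J t a * word_sum J t b \<le> K powr t * word_sum J t (a + b)"
proof -
  have "word_sum J t a * word_sum J t b = (\<Sum>v\<in>words J a. \<Sum>u\<in>words J b. ratio v powr t * ratio u powr t)"
    by (simp add: word_sum_def sum_product)
  also have "\<dots> \<le> (\<Sum>v\<in>words J a. \<Sum>u\<in>words J b. K powr t * ratio (v @ u) powr t)"
  proof (intro sum_mono)
    fix v u assume "v \<in> words J a" "u \<in> words J b"
    then have vu: "v \<in> lists I" "u \<in> lists I" using words_subset_lists[OF J(2)] by blast+
    then have "(ratio v * ratio u) powr t \<le> (K * ratio (v @ u)) powr t"
      using ratio_append(2)[OF vu] ratio_pos[of v] ratio_pos[of u] assms(3) by (intro powr_mono2) auto
    moreover have "0 < ratio (v @ u)" using vu by (intro ratio_pos) simp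
    ultimately show "ratio v powr t * ratio u powr t \<le> K powr t * ratio (v @ u) powr t"
      using ratio_pos[of v] ratio_pos[of u] vu K by (simp add: powr_mult)
  qed
  also have "\<dots> = K powr t * word_sum J t (a + b)"
    by (simp add: word_sum_def sum_words_append[OF J(1)] sum_distrib_left)
  finally show ?thesis .
qed

text \<open>After division by \<open>K powr t\<close> the sums are supermultiplicative. Since the
  normalized value at \<open>n\<close> is at least 1, raising the level by \<open>n\<close> never
  decreases them, so their minimum over the levels below \<open>n\<close> is a bound.\<close>

lemma word_sum_bounded_below:
  assumes J: "finite J" "J \<subseteq> I" "J \<noteq> {}" and "0 \<le> t" and large: "K powr t \<le> word_sum J t n" and "0 < n"
  obtains \<kappa> where "0 < \<kappa>" "\<And>k. \<kappa> \<le> word_sum J t k"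
proof -
  define q where "q k = word_sum J t k / K powr t" for k
  have Kt: "0 < K powr t" using K by simp
  have q: "0 < q k" for k using word_sum_pos[OF J] Kt by (simp add: q_def)
  have super: "q a * q b \<le> q (a + b)" for a b
    using word_sum_supermultiplicative[OF J(1,2) assms(4), of a b] Kt by (simp add: q_def field_simps)
  have "1 \<le> q n" using large Kt by (simp add: q_def)
  define \<kappa> where "\<kappa> = Min (q ` {..<n})"
  have "\<kappa> \<le> q k" for k
  proof (induction k rule: less_induct)
    case (less k)
    show ?case
    proof (cases "k < n")
      case False
      then have "\<kappa> \<le> q (k - n)" using \<open>0 < n\<close> by (intro less) simp
      also have "\<dots> \<le> q n * q (k - n)" using \<open>1 \<le> q n\<close> q[of "k - n"] by simp
      also have "\<dots> \<le> q k" using super[of n "k - n"] False by simp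
      finally show ?thesis .
    qed (simp add: \<kappa>_def)
  qed
  then have "\<kappa> * K powr t \<le> word_sum J t k" for k
    using Kt by (simp add: q_def pos_le_divide_eq)
  moreover have "0 < \<kappa>" using q \<open>0 < n\<close> unfolding \<kappa>_def by (subst Min_gr_iff) auto
  ultimately show thesis using that[of "\<kappa> * K powr t"] Kt by simp
qed

section \<open>Word sums at exponents of zero Hausdorff measure\<close>

lemma cyl_append_subset:
  assumes "v \<in> lists I" "u \<in> lists I"
  shows "cyl (v @ u) ` X \<subseteq> cyl v ` X"
  using image_mono[OF cyl_maps(1)[OF assms(2)], of "cyl v"] by (simp add: word_map_append image_comp)

lemma compact_cyl: "w \<in> lists I \<Longrightarrow> compact (cyl w ` X)"
  using conformal_on_continuous_on[OF cyl_conformal] X_subset_V compact_X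
  by (metis compact_continuous_image continuous_on_subset)

lemma dist_le_diameter_X: "x \<in> X \<Longrightarrow> y \<in> X \<Longrightarrow> dist x y \<le> diameter X"
  by (simp add: compact_imp_bounded compact_X diameter_bounded_bound)

text \<open>Otherwise Koenig's lemma gives an infinite branch all of whose cylinders are large, but the
  cylinders shrink to a point of the limit set.\<close>

lemma cover_refined_by_words:
  assumes J: "finite J" "J \<subseteq> I" and cover: "lim_set \<subseteq> \<Union>\<U>" "\<And>U. U \<in> \<U> \<Longrightarrow> open U"
  obtains m where "\<And>w. w \<in> words J m \<Longrightarrow> \<exists>U\<in>\<U>. cyl w ` X \<subseteq> U"
proof -
  define small where "small w \<longleftrightarrow> (\<exists>U\<in>\<U>. cyl w ` X \<subseteq> U)" for w
  \<comment> \<open>A word is good if all its extensions by some fixed number of letters are small.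
    As \<open>J\<close> is finite and smallness passes to extensions, a bad word has a bad child;
    this yields the infinite branch.\<close>
  define good where "good w \<longleftrightarrow> (\<exists>m. \<forall>u\<in>words J m. small (w @ u))" for w
  have small_append: "small (v @ u)" if "small v" "v \<in> lists I" "u \<in> lists I" for v u
    using that(1) subset_trans[OF cyl_append_subset[OF that(2,3)]] unfolding small_def by meson
  have step: "\<exists>i\<in>J. \<not> good (w @ [i])" if w: "w \<in> lists I" "\<not> good w" for w
  proof (rule ccontr)
    assume "\<not> ?thesis"
    then have "\<forall>i\<in>J. \<exists>m. \<forall>u\<in>words J m. small (w @ [i] @ u)"
      unfolding good_def by simp
    then obtain m where m: "\<And>i u. i \<in> J \<Longrightarrow> u \<in> words J (m i) \<Longrightarrow> small (w @ [i] @ u)"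
      by (auto dest!: bchoice)
    define n where "n = Max (m ` J)"
    have "small (w @ u)" if u: "u \<in> words J (Suc n)" for u
    proof -
      obtain i u' where iu: "u = i # u'" "i \<in> J" "u' \<in> words J n"
        using u by (cases u) (auto simp: words_def)
      have "m i \<le> n" using iu(2) J(1) by (simp add: n_def)
      then have t: "take (m i) u' \<in> words J (m i)" using iu(3) by (intro words_take)
      have d: "drop (m i) u' \<in> lists I"
        using words_drop[OF iu(3)] words_subset_lists[OF J(2)] by blast
      have "w @ [i] @ take (m i) u' \<in> lists I"
        using w(1) iu(2) t words_subset_lists[OF J(2)] J(2) by auto
      from small_append[OF m[OF iu(2) t] this d] show ?thesis
        by (simp add: iu(1))
    qed
    then have "good w" unfolding good_def by blast
    with w(2) show False ..
  qed
  have "good []"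
  proof (rule ccontr)
    assume bad: "\<not> good []"
    define nxt where "nxt w = (SOME i. i \<in> J \<and> \<not> good (w @ [i]))" for w
    have nxt: "nxt w \<in> J" "\<not> good (w @ [nxt w])" if "w \<in> lists I" "\<not> good w" for w
      using someI_ex[of "\<lambda>i. i \<in> J \<and> \<not> good (w @ [i])"] step[OF that] unfolding nxt_def by blast+
    define W where "W = rec_nat [] (\<lambda>_ w. w @ [nxt w])"
    have W_0: "W 0 = []" and W_Suc: "W (Suc n) = W n @ [nxt (W n)]" for n
      by (simp_all add: W_def)
    have W: "W n \<in> lists J \<and> \<not> good (W n)" for n
    proof (induction n)
      case (Suc n)
      then have "W n \<in> lists I" using J(2) by auto
      with nxt[OF this] Suc show ?case by (simp add: W_Suc)
    qed (simp add: W_0 bad)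
    then have WI: "W n \<in> lists I" for n using J(2) lists_mono by blast
    define \<gamma> where "\<gamma> n = nxt (W n)" for n
    have \<gamma>W: "map \<gamma> [0..<n] = W n" for n
      by (induction n) (simp_all add: W_0 W_Suc \<gamma>_def)
    have "\<gamma> n \<in> I" for n
      using nxt(1)[OF WI] W J(2) by (auto simp: \<gamma>_def)
    then have \<gamma>: "range \<gamma> \<subseteq> I" by blast
    have len: "length (W n) = n" for n
      by (metis \<gamma>W length_map length_upt minus_nat.diff_0)
    have "(\<Inter>n. cyl (W n) ` X) \<noteq> {}"
    proof (rule compact_nest)
      show "compact (cyl (W n) ` X)" "cyl (W n) ` X \<noteq> {}" for n
        using compact_cyl[OF WI] base_point(2) by auto
      have "decseq (\<lambda>n. cyl (W n) ` X)"
      proof (rule decseq_SucI)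
        show "cyl (W (Suc n)) ` X \<subseteq> cyl (W n) ` X" for n
          using cyl_append_subset[OF WI[of n], of "[nxt (W n)]"] WI[of "Suc n"] unfolding W_Suc by auto
      qed
      then show "cyl (W n) ` X \<subseteq> cyl (W m) ` X" if "m \<le> n" for m n
        using that by (simp add: decseq_def)
    qed
    then obtain x where x: "\<And>n. x \<in> cyl (W n) ` X" by blast
    then have "x \<in> (\<Inter>n\<in>{1..}. cyl (map \<gamma> [0..<n]) ` X)"
      unfolding \<gamma>W by blast
    then have "x \<in> lim_set"
      unfolding limit_set_def using \<gamma> by blast
    then obtain U where U: "U \<in> \<U>" "x \<in> U" using cover(1) by blast
    then obtain e where e: "0 < e" "ball x e \<subseteq> U"
      using cover(2) open_contains_ball by blast
    have "(\<lambda>n. c ^ n * diameter X) \<longlonglongrightarrow> 0"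
      using c by (intro tendsto_mult_left_zero LIMSEQ_power_zero) simp
    then have "eventually (\<lambda>n. c ^ n * diameter X < e) sequentially"
      using e(1) by (rule order_tendstoD)
    then obtain n where n: "c ^ n * diameter X < e"
      using eventually_happens'[OF sequentially_bot] by blast
    have "cyl (W n) ` X \<subseteq> ball x e"
    proof
      fix y assume "y \<in> cyl (W n) ` X"
      then obtain p q where pq: "x = cyl (W n) p" "p \<in> X" "y = cyl (W n) q" "q \<in> X"
        using x[of n] by blast
      have "dist x y \<le> c ^ n * dist p q"
        using cyl_contraction[OF WI pq(2,4), of n] pq len by simp
      also have "\<dots> \<le> c ^ n * diameter X"
        using c pq by (intro mult_left_mono dist_le_diameter_X) auto
      finally show "y \<in> ball x e" using n by simp
    qed
    then have "small (W n)" using e(2) U(1) unfolding small_def by blast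
    then have "good (W n)" unfolding good_def by (intro exI[of _ 0]) simp
    with W show False by blast
  qed
  then show thesis using that unfolding good_def small_def by auto
qed

text \<open>The cylinders have disjoint interiors, each containing a ball of radius
  \<open>\<kappa> * b * r\<close>. Their diameters are at most \<open>L * C * r * diameter X\<close>
  and they meet \<open>ball x r\<close>, so all lie in \<open>ball x (B * r)\<close>; volumes are
  then compared.\<close>

lemma card_antichain_le:
  fixes C b :: real
  assumes "0 < b" "0 \<le> C"
  obtains M where "0 < M"
    "\<And>A x r. \<lbrakk>finite A; A \<subseteq> lists I; 0 < r; \<And>v w. v \<in> A \<Longrightarrow> w \<in> A \<Longrightarrow> prefix v w \<Longrightarrow> v = w;
        \<And>v. v \<in> A \<Longrightarrow> b * r \<le> ratio v; \<And>v. v \<in> A \<Longrightarrow> ratio v \<le> C * r;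
        \<And>v. v \<in> A \<Longrightarrow> cyl v ` X \<inter> ball x r \<noteq> {}\<rbrakk> \<Longrightarrow> real (card A) \<le> M"
proof -
  obtain L where L: "1 \<le> L" "\<And>w x y. w \<in> lists I \<Longrightarrow> x \<in> X \<Longrightarrow> y \<in> X \<Longrightarrow> dist (cyl w x) (cyl w y) \<le> L * ratio w * dist x y"
    using cyl_Lipschitz by metis
  obtain \<kappa> where \<kappa>: "0 < \<kappa>" "\<And>w. w \<in> lists I \<Longrightarrow> ball (cyl w base_point) (\<kappa> * ratio w) \<subseteq> cyl w ` interior X"
    using cyl_contains_ball by metis
  define B where "B = 1 + L * C * diameter X"
  have dX: "0 \<le> diameter X" by (simp add: compact_imp_bounded compact_X diameter_ge_0)
  have B: "1 \<le> B" using L assms dX by (simp add: B_def)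
  define M where "M = (B / (\<kappa> * b)) ^ CARD('d)"
  have main: "real (card A) \<le> M"
    if A: "finite A" "A \<subseteq> lists I" and r: "0 < r" and anti: "\<And>v w. v \<in> A \<Longrightarrow> w \<in> A \<Longrightarrow> prefix v w \<Longrightarrow> v = w"
      and lo: "\<And>v. v \<in> A \<Longrightarrow> b * r \<le> ratio v" and hi: "\<And>v. v \<in> A \<Longrightarrow> ratio v \<le> C * r"
      and meet: "\<And>v. v \<in> A \<Longrightarrow> cyl v ` X \<inter> ball x r \<noteq> {}" for A x r
  proof -
    have inside: "ball (cyl v base_point) (\<kappa> * b * r) \<subseteq> cyl v ` interior X" if "v \<in> A" for v
    proof -
      have "\<kappa> * b * r \<le> \<kappa> * ratio v" using lo[OF that] \<kappa>(1) by (simp add: mult.assoc)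
      then show ?thesis using \<kappa>(2)[of v] that A(2) subset_ball[of "\<kappa> * b * r" "\<kappa> * ratio v"] by blast
    qed
    have "real (card A) \<le> ((B * r) / (\<kappa> * b * r)) ^ DIM(real^'d)"
    proof (rule card_disjoint_balls_le[where c = "\<lambda>v. cyl v base_point" and z = x])
      fix v assume v: "v \<in> A"
      then have vI: "v \<in> lists I" using A by blast
      obtain p where p: "p \<in> X" "dist x (cyl v p) < r" using meet[OF v] by auto
      have "cyl v ` X \<subseteq> ball x (B * r)"
      proof
        fix y assume "y \<in> cyl v ` X"
        then obtain q where q: "q \<in> X" "y = cyl v q" by blast
        have "dist (cyl v p) y \<le> L * ratio v * dist p q" using L(2)[OF vI p(1) q(1)] q(2) by simp
        also have "\<dots> \<le> L * (C * r) * diameter X"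
          using L(1) hi[OF v] dist_le_diameter_X[OF p(1) q(1)] ratio_pos[OF vI] by (intro mult_mono) auto
        finally show "y \<in> ball x (B * r)"
          using p(2) dist_triangle[of x y "cyl v p"] by (simp add: B_def algebra_simps)
      qed
      then show "ball (cyl v base_point) (\<kappa> * b * r) \<subseteq> ball x (B * r)"
        using inside[OF v] interior_subset[of X] by blast
    next
      show "disjoint_family_on (\<lambda>v. ball (cyl v base_point) (\<kappa> * b * r)) A"
        unfolding disjoint_family_on_def
      proof (intro ballI impI)
        fix v w assume "v \<in> A" "w \<in> A" "v \<noteq> w"
        then have "cyl v ` interior X \<inter> cyl w ` interior X = {}"
          using A(2) anti by (intro cyl_disjoint) blast+
        then show "ball (cyl v base_point) (\<kappa> * b * r) \<inter> ball (cyl w base_point) (\<kappa> * b * r) = {}"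
          using inside[OF \<open>v \<in> A\<close>] inside[OF \<open>w \<in> A\<close>] by blast
      qed
    qed (use A r B \<kappa> assms in auto)
    then show ?thesis using r by (simp add: M_def)
  qed
  have "0 < M" using B \<kappa> assms by (simp add: M_def)
  then show thesis by (rule that[OF _ main])
qed

text \<open>If the sum were larger, then all word sums would be bounded below, and a cover of small total
  weight would lead to a contradiction: charge every word of a deep level, weighted by \<open>ratio w powr t\<close>,
  to its shortest prefix whose ratio is comparable to the radius of a ball containing the cylinder.\<close>

lemma word_sum_le:
  assumes J: "finite J" "J \<subseteq> I" and t: "0 < t" and null: "hausdorff_measure t lim_set = 0"
  shows "word_sum J t n \<le> K powr t"
proof (rule ccontr)
  assume "\<not> ?thesis"
  then have large: "K powr t < word_sum J t n" by simp
  have K1: "1 \<le> K powr t" using K t by (simp add: ge_one_powr_ge_zero)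
  have "n \<noteq> 0" using large K1 by (intro notI) (simp add: word_sum_def)
  have "J \<noteq> {}"
  proof
    assume "J = {}"
    then have "words J n = {}" using \<open>n \<noteq> 0\<close> by (auto simp: words_def)
    then show False using large K1 by (simp add: word_sum_def)
  qed
  obtain \<kappa> where \<kappa>: "0 < \<kappa>" "\<And>k. \<kappa> \<le> word_sum J t k"
    using word_sum_bounded_below[OF J \<open>J \<noteq> {}\<close>, of t n] t large \<open>n \<noteq> 0\<close> by auto
  obtain \<beta> where \<beta>: "0 < \<beta>" "\<And>w. w \<in> lists I \<Longrightarrow> ball (cyl w base_point) (\<beta> * ratio w) \<subseteq> cyl w ` interior X"
    using cyl_contains_ball by metis
  \<comment> \<open>A cylinder inside a ball of radius \<open>r\<close> contains a ball of radius
    \<open>\<beta> * ratio w\<close>, which forces its ratio to be at most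
    \<open>C * r\<close>.\<close>
  define C where "C = 1 / \<beta>"
  have C: "0 < C" using \<beta>(1) by (simp add: C_def)
  have small: "ratio w \<le> C * r" if "w \<in> lists I" "cyl w ` X \<subseteq> ball x r" "0 < r" for w x r
  proof -
    have "ball (cyl w base_point) (\<beta> * ratio w) \<subseteq> ball x r"
      using \<beta>(2)[OF that(1)] that(2) interior_subset[of X] by blast
    moreover have "0 < \<beta> * ratio w" using \<beta>(1) ratio_pos[OF that(1)] by simp
    ultimately have "\<beta> * ratio w \<le> r"
      unfolding ball_subset_ball_iff using zero_le_dist[of "cyl w base_point" x] by linarith
    then show ?thesis using \<beta>(1) by (simp add: C_def field_simps)
  qed
  \<comment> \<open>Appending one letter of \<open>J\<close> multiplies the ratio by at least
    \<open>b0\<close>, which is positive because \<open>J\<close> is finite. So the ratio cannot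
    drop far below a threshold when first crossing it.\<close>
  define b0 where "b0 = Min ((\<lambda>i. ratio [i]) ` J) / K"
  have "0 < Min ((\<lambda>i. ratio [i]) ` J)"
    using J \<open>J \<noteq> {}\<close> by (subst Min_gr_iff) (auto intro!: ratio_pos)
  then have b0: "0 < b0"
    using K by (simp add: b0_def)
  have b0_le: "b0 \<le> ratio [i] / K" if "i \<in> J" for i
    unfolding b0_def using J(1) that K by (intro divide_right_mono Min_le) auto
  \<comment> \<open>The bound 1 covers the case that the empty word is already stopped: its ratio is
    1, and all radii will be at most 1.\<close>
  define b where "b = min 1 (C * b0)"
  have b: "0 < b" "b \<le> 1" "b \<le> C * b0" using C b0 by (auto simp: b_def)
  obtain M where M: "0 < M"
    "\<And>A x r. \<lbrakk>finite A; A \<subseteq> lists I; 0 < r; \<And>v w. v \<in> A \<Longrightarrow> w \<in> A \<Longrightarrow> prefix v w \<Longrightarrow> v = w;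
        \<And>v. v \<in> A \<Longrightarrow> b * r \<le> ratio v; \<And>v. v \<in> A \<Longrightarrow> ratio v \<le> C * r;
        \<And>v. v \<in> A \<Longrightarrow> cyl v ` X \<inter> ball x r \<noteq> {}\<rbrakk> \<Longrightarrow> real (card A) \<le> M"
    using card_antichain_le[OF b(1) less_imp_le[OF C]] by metis
  \<comment> \<open>\<open>B\<close> collects the constants of the estimate \<open>group\<close>
    below; \<open>\<eta>\<close> then makes \<open>B * \<eta>\<close> at most one half.\<close>
  define B where "B = M * (K powr t * C powr t * (K powr t / \<kappa>))"
  have B: "0 < B" using M(1) K C \<kappa>(1) by (simp add: B_def)
  define \<eta> where "\<eta> = min 1 (1 / (2 * B))"
  have \<eta>: "0 < \<eta>" "\<eta> \<le> 1" "B * \<eta> \<le> 1 / 2"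
    using B by (auto simp: \<eta>_def min_def field_simps)
  obtain x d where d: "\<And>k. 0 < d k" and cover: "lim_set \<subseteq> (\<Union>k. ball (x k) (d k))"
    and summ: "summable (\<lambda>k. d k powr t)" and sum_le: "(\<Sum>k. d k powr t) \<le> \<eta>"
    by (rule hausdorff_measure_0_cover[OF null t \<eta>(1)]) (rule that; assumption)
  have d1: "d k \<le> 1" for k
  proof -
    have "d k powr t \<le> (\<Sum>k. d k powr t)"
      using sum_le_suminf[OF summ, of "{k}"] by simp
    then have "d k powr t \<le> 1" using sum_le \<eta>(2) by simp
    moreover have "1 powr t < d k powr t" if "1 < d k"
      using t that by (intro powr_less_mono2) auto
    ultimately show ?thesis by force
  qed
  define \<U> where "\<U> = range (\<lambda>k. ball (x k) (d k))"
  have "lim_set \<subseteq> \<Union>\<U>" and "\<And>U. U \<in> \<U> \<Longrightarrow> open U"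
    using cover by (auto simp: \<U>_def)
  then obtain m where "\<And>w. w \<in> words J m \<Longrightarrow> \<exists>U\<in>\<U>. cyl w ` X \<subseteq> U"
    by (rule cover_refined_by_words[OF J]) (assumption, rule that)
  then have "\<forall>w\<in>words J m. \<exists>k. cyl w ` X \<subseteq> ball (x k) (d k)"
    by (fastforce simp: \<U>_def)
  then obtain \<iota> where \<iota>: "\<And>w. w \<in> words J m \<Longrightarrow> cyl w ` X \<subseteq> ball (x (\<iota> w)) (d (\<iota> w))"
    by (auto dest!: bchoice)
  have wI: "w \<in> lists I" if "w \<in> words J k" for w k
    using that words_subset_lists[OF J(2)] by blast
  \<comment> \<open>Words assigned to the same ball share the threshold
    \<open>C * d (\<iota> w)\<close>, so stopping at the first crossing makes their stopped prefixes
    an antichain.\<close>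
  define stop where "stop w = (LEAST j. ratio (take j w) \<le> C * d (\<iota> w))" for w
  have stop: "ratio (take (stop w) w) \<le> C * d (\<iota> w)" "stop w \<le> m"
    and before_stop: "j < stop w \<Longrightarrow> C * d (\<iota> w) < ratio (take j w)" if w: "w \<in> words J m" for w j
  proof -
    have *: "ratio (take m w) \<le> C * d (\<iota> w)"
      using small[OF wI[OF w] \<iota>[OF w] d] w by (simp add: words_def)
    show "ratio (take (stop w) w) \<le> C * d (\<iota> w)"
      unfolding stop_def by (rule LeastI[of "\<lambda>j. ratio (take j w) \<le> C * d (\<iota> w)", OF *])
    show "stop w \<le> m"
      unfolding stop_def by (rule Least_le[of "\<lambda>j. ratio (take j w) \<le> C * d (\<iota> w)", OF *])
    show "C * d (\<iota> w) < ratio (take j w)" if "j < stop w"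
      using not_less_Least[of j "\<lambda>j. ratio (take j w) \<le> C * d (\<iota> w)"] that unfolding stop_def by simp
  qed
  have take_in: "take (stop w) w \<in> words J (stop w)" if "w \<in> words J m" for w
    using words_take[OF that stop(2)[OF that]] .
  have ratio_stop: "b * d (\<iota> w) \<le> ratio (take (stop w) w)" if w: "w \<in> words J m" for w
  proof (cases "stop w")
    case 0
    then show ?thesis using b d1[of "\<iota> w"] d[of "\<iota> w"] by (simp add: mult_le_one)
  next
    case (Suc j)
    have j: "j < m" using Suc stop(2)[OF w] by simp
    let ?v = "take j w" and ?i = "w ! j"
    have v: "?v \<in> lists I" using words_take[OF w, of j] j wI by simp
    have i: "?i \<in> J" using w j by (auto simp: words_def)
    have split: "take (stop w) w = ?v @ [?i]"
      using w j Suc by (simp add: words_def take_Suc_conv_app_nth)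
    have "b * d (\<iota> w) \<le> (C * d (\<iota> w)) * b0"
      using b(3) d[of "\<iota> w"] by (simp add: mult.commute mult.left_commute)
    also have "\<dots> \<le> ratio ?v * (ratio [?i] / K)"
      using before_stop[OF w, of j] Suc b0 b0_le[OF i] C d[of "\<iota> w"] ratio_pos[OF v] by (intro mult_mono) auto
    also have "\<dots> \<le> ratio (?v @ [?i])"
      using ratio_append(2)[OF v, of "[?i]"] i J(2) K by (auto simp: field_simps)
    finally show ?thesis by (simp add: split)
  qed
  define WW where "WW = words J m"
  have fin: "finite WW" using finite_words[OF J(1)] by (simp add: WW_def)
  define Z where "Z = word_sum J t m"
  have Z: "0 < Z" using word_sum_pos[OF J \<open>J \<noteq> {}\<close>] by (simp add: Z_def)
  \<comment> \<open>This is where the lower bound \<open>\<kappa>\<close> enters: together with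
    supermultiplicativity it bounds the sums of all lower levels by a multiple of
    \<open>Z\<close>.\<close>
  have tail: "word_sum J t (m - j) \<le> K powr t / \<kappa> * Z" if "j \<le> m" for j
  proof -
    have "\<kappa> * word_sum J t (m - j) \<le> word_sum J t j * word_sum J t (m - j)"
      using \<kappa>(2)[of j] word_sum_pos[OF J \<open>J \<noteq> {}\<close>, of t "m - j"] by simp
    also have "\<dots> \<le> K powr t * Z"
      using word_sum_supermultiplicative[OF J, of t j "m - j"] t that by (simp add: Z_def)
    finally show ?thesis using \<kappa>(1) by (simp add: field_simps)
  qed
  define A where "A k = (\<lambda>w. take (stop w) w) ` {w \<in> WW. \<iota> w = k}" for k
  have finA: "finite (A k)" for k using fin by (simp add: A_def)
  have cardA: "real (card (A k)) \<le> M" for k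
  proof (rule M(2)[of "A k" "d k" "x k"])
    show "A k \<subseteq> lists I" using take_in wI by (auto simp: A_def WW_def)
    show "v = v'" if "v \<in> A k" "v' \<in> A k" and pre: "prefix v v'" for v v'
    proof -
      obtain w where w: "w \<in> words J m" "\<iota> w = k" "v = take (stop w) w"
        using \<open>v \<in> A k\<close> by (auto simp: A_def WW_def)
      obtain w' where w': "w' \<in> words J m" "\<iota> w' = k" "v' = take (stop w') w'"
        using \<open>v' \<in> A k\<close> by (auto simp: A_def WW_def)
      have lv: "length v = stop w" and lv': "length v' = stop w'"
        using w(3) w'(3) take_in[OF w(1)] take_in[OF w'(1)] by (simp_all add: words_def)
      have "v = take (stop w) v'" using pre lv by (metis append_eq_conv_conj prefix_def)
      moreover have le: "stop w \<le> stop w'" using prefix_length_le[OF pre] lv lv' by simp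
      ultimately have v: "v = take (stop w) w'" using w'(3) by (simp add: min_absorb1)
      have "\<not> stop w < stop w'"
        using before_stop[OF w'(1), of "stop w"] stop(1)[OF w(1)] w(2,3) w'(2) v by auto
      then show "v = v'" using v w'(3) le by simp
    qed
    show "b * d k \<le> ratio v" "ratio v \<le> C * d k" if "v \<in> A k" for v
      using that ratio_stop stop(1) by (auto simp: A_def WW_def)
    show "cyl v ` X \<inter> ball (x k) (d k) \<noteq> {}" if "v \<in> A k" for v
    proof -
      obtain w where w: "w \<in> words J m" "\<iota> w = k" "v = take (stop w) w"
        using \<open>v \<in> A k\<close> by (auto simp: A_def WW_def)
      have "cyl w ` X \<subseteq> cyl v ` X"
        using cyl_append_subset[of v "drop (stop w) w"] w(3) take_in[OF w(1)] words_drop[OF w(1), of "stop w"] wI by simp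
      moreover have "cyl w ` X \<subseteq> ball (x k) (d k)" using \<iota>[OF w(1)] w(2) by simp
      moreover have "cyl w ` X \<noteq> {}" using base_point(2) by blast
      ultimately show ?thesis by blast
    qed
  qed (use finA d in auto)
  \<comment> \<open>Ball \<open>k\<close> is charged through at most \<open>M\<close> stopped
    prefixes. Each has ratio at most \<open>C * d k\<close>, and the tails below it contribute at
    most a multiple of \<open>Z\<close>.\<close>
  have group: "(\<Sum>w | w \<in> WW \<and> \<iota> w = k. ratio w powr t) \<le> B * Z * d k powr t" for k
  proof -
    have "(\<Sum>w | w \<in> WW \<and> \<iota> w = k. ratio w powr t)
        = (\<Sum>v\<in>A k. \<Sum>w | w \<in> {w \<in> WW. \<iota> w = k} \<and> take (stop w) w = v. ratio w powr t)"
      using fin finA[of k] by (intro sum.group[symmetric]) (auto simp: A_def)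
    also have "\<dots> \<le> (\<Sum>v\<in>A k. K powr t * (C * d k) powr t * (K powr t / \<kappa> * Z))"
    proof (rule sum_mono)
      fix v assume "v \<in> A k"
      then obtain w where w: "w \<in> words J m" "\<iota> w = k" "v = take (stop w) w"
        by (auto simp: A_def WW_def)
      let ?j = "length v"
      have v: "v \<in> words J ?j" "?j \<le> m"
        using take_in[OF w(1)] w(3) stop(2)[OF w(1)] by (auto simp: words_def)
      have "(\<Sum>w | w \<in> {w \<in> WW. \<iota> w = k} \<and> take (stop w) w = v. ratio w powr t)
          \<le> (\<Sum>w | w \<in> words J m \<and> take ?j w = v. ratio w powr t)"
      proof (rule sum_mono2)
        show "finite {w \<in> words J m. take ?j w = v}" using fin by (simp add: WW_def)
      qed (auto simp: WW_def words_def min_def)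
      also have "\<dots> \<le> K powr t * ratio v powr t * word_sum J t (m - ?j)"
        using t by (intro word_sum_extensions_le[OF J _ v]) simp
      also have "\<dots> \<le> K powr t * (C * d k) powr t * (K powr t / \<kappa> * Z)"
        using stop(1)[OF w(1)] w(2,3) t tail[OF v(2)] ratio_pos[OF wI[OF v(1)]]
          word_sum_pos[OF J \<open>J \<noteq> {}\<close>, of t "m - ?j"] K
        by (intro mult_mono powr_mono2) auto
      finally show "(\<Sum>w | w \<in> {w \<in> WW. \<iota> w = k} \<and> take (stop w) w = v. ratio w powr t)
          \<le> K powr t * (C * d k) powr t * (K powr t / \<kappa> * Z)" .
    qed
    also have "\<dots> = real (card (A k)) * (K powr t * (C * d k) powr t * (K powr t / \<kappa> * Z))"
      by simp
    also have "\<dots> \<le> M * (K powr t * (C * d k) powr t * (K powr t / \<kappa> * Z))"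
      using cardA[of k] \<kappa>(1) Z by (intro mult_right_mono) auto
    also have "\<dots> = B * Z * d k powr t"
      using C d[of k] by (simp add: B_def powr_mult)
    finally show ?thesis .
  qed
  \<comment> \<open>Summing the charges over the balls gives that \<open>Z\<close> is at most
    \<open>Z / 2\<close>.\<close>
  have "Z = (\<Sum>k\<in>\<iota> ` WW. \<Sum>w | w \<in> WW \<and> \<iota> w = k. ratio w powr t)"
    unfolding Z_def word_sum_def WW_def[symmetric] using fin by (intro sum.group[symmetric]) auto
  also have "\<dots> \<le> (\<Sum>k\<in>\<iota> ` WW. B * Z * d k powr t)"
    by (rule sum_mono) (rule group)
  also have "\<dots> = B * Z * (\<Sum>k\<in>\<iota> ` WW. d k powr t)"
    by (simp add: sum_distrib_left)
  also have "\<dots> \<le> B * Z * \<eta>"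
  proof (rule mult_left_mono)
    have "(\<Sum>k\<in>\<iota> ` WW. d k powr t) \<le> (\<Sum>k. d k powr t)"
      using fin by (intro sum_le_suminf[OF summ]) auto
    then show "(\<Sum>k\<in>\<iota> ` WW. d k powr t) \<le> \<eta>" using sum_le by simp
  qed (use B Z in simp)
  also have "\<dots> \<le> 1 / 2 * Z"
    using \<eta>(3) Z mult_right_mono[of "B * \<eta>" "1 / 2" Z] by (simp add: mult_ac)
  finally show False using Z by simp
qed

text \<open>For \<open>s\<close> strictly between the dimension and \<open>t\<close>, each level sum
  with exponent \<open>s\<close> is at most \<open>K powr s\<close>, whatever the finite alphabet.
  The remaining factor \<open>ratio w powr (t - s)\<close> decays geometrically with the length, so
  the levels can be summed.\<close>

lemma finite_word_sums_bounded:
  assumes "hausdorff_dim lim_set < ereal t"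
  obtains C where "0 < C" "\<And>W. finite W \<Longrightarrow> W \<subseteq> lists I \<Longrightarrow> (\<Sum>w\<in>W. ratio w powr t) \<le> C"
proof -
  obtain s where s: "hausdorff_dim lim_set < ereal s" "s < t"
    using ereal_dense2[OF assms] by auto
  note null = hausdorff_dim_lessD[OF s(1)]
  define \<rho> where "\<rho> = c powr (t - s)"
  have \<rho>: "0 \<le> \<rho>" "\<rho> < 1"
    using c s(2) powr_less_mono2[of "t - s" c 1] by (auto simp: \<rho>_def)
  define C where "C = K powr s / (1 - \<rho>)"
  have main: "(\<Sum>w\<in>W. ratio w powr t) \<le> C" if W: "finite W" "W \<subseteq> lists I" for W
  proof -
    define J where "J = (\<Union>w\<in>W. set w)"
    define N where "N = Suc (Max (insert 0 (length ` W)))"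
    have J: "finite J" "J \<subseteq> I" using W by (auto simp: J_def)
    have len: "length w < N" if "w \<in> W" for w
      using W(1) that by (simp add: N_def less_Suc_eq_le)
    have "(\<Sum>w\<in>W. ratio w powr t) = (\<Sum>n<N. \<Sum>w | w \<in> W \<and> length w = n. ratio w powr t)"
      using W(1) len by (intro sum.group[symmetric]) auto
    also have "\<dots> \<le> (\<Sum>n<N. K powr s * \<rho> ^ n)"
    proof (rule sum_mono)
      fix n
      have "(\<Sum>w | w \<in> W \<and> length w = n. ratio w powr t) \<le> (\<Sum>w\<in>words J n. ratio w powr t)"
        using finite_words[OF J(1)] by (intro sum_mono2) (auto simp: words_def J_def)
      also have "\<dots> \<le> (\<Sum>w\<in>words J n. \<rho> ^ n * ratio w powr s)"
      proof (rule sum_mono)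
        fix w assume w: "w \<in> words J n"
        then have wI: "w \<in> lists I" using words_subset_lists[OF J(2)] by blast
        have "ratio w powr t = ratio w powr (t - s) * ratio w powr s"
          by (simp add: powr_add[symmetric])
        also have "\<dots> \<le> (c ^ n) powr (t - s) * ratio w powr s"
          using ratio_le_power[OF wI] ratio_pos[OF wI] w s(2)
          by (intro mult_right_mono powr_mono2) (auto simp: words_def)
        also have "(c ^ n) powr (t - s) = \<rho> ^ n"
          using c by (simp add: \<rho>_def powr_realpow[symmetric] powr_powr mult.commute)
        finally show "ratio w powr t \<le> \<rho> ^ n * ratio w powr s" .
      qed
      also have "\<dots> = \<rho> ^ n * word_sum J s n"
        by (simp add: word_sum_def sum_distrib_left)
      also have "\<dots> \<le> \<rho> ^ n * K powr s"
        using \<rho> word_sum_le[OF J null] by (intro mult_left_mono) auto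
      finally show "(\<Sum>w | w \<in> W \<and> length w = n. ratio w powr t) \<le> K powr s * \<rho> ^ n"
        by (simp add: mult.commute)
    qed
    also have "\<dots> = K powr s * (\<Sum>n<N. \<rho> ^ n)"
      by (simp add: sum_distrib_left)
    also have "\<dots> \<le> K powr s * (1 / (1 - \<rho>))"
    proof (rule mult_left_mono)
      have "(\<Sum>n<N. \<rho> ^ n) \<le> (\<Sum>n. \<rho> ^ n)"
        using \<rho> by (intro sum_le_suminf summable_geometric) auto
      then show "(\<Sum>n<N. \<rho> ^ n) \<le> 1 / (1 - \<rho>)"
        using \<rho> by (simp add: suminf_geometric)
    qed simp
    finally show ?thesis by (simp add: C_def)
  qed
  have "0 < C" using \<rho> K by (simp add: C_def)
  then show thesis by (rule that[OF _ main])
qed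

section \<open>Covering the limit set through the fixed points\<close>

abbreviation "fix_set \<equiv> fixed_points X I T"

lemma limit_set_subset: "lim_set \<subseteq> X"
proof
  fix x assume "x \<in> lim_set"
  then obtain \<gamma> :: "nat \<Rightarrow> 'i" where \<gamma>: "range \<gamma> \<subseteq> I" "x \<in> cyl (map \<gamma> [0..<1]) ` X"
    unfolding limit_set_def by blast
  then have "map \<gamma> [0..<1] \<in> lists I" by auto
  then show "x \<in> X" using cyl_maps(1) \<gamma>(2) by blast
qed

lemma fixed_points_subset: "fix_set \<subseteq> lim_set"
proof
  fix x assume "x \<in> fix_set"
  then obtain i where i: "i \<in> I" "x \<in> X" "T i x = x" by (auto simp: fixed_points_def)
  have "cyl (replicate n i) x = x" for n
    by (induction n) (simp_all add: i)
  then have "x \<in> cyl (map (\<lambda>_. i) [0..<n]) ` X" for n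
    using i(2) by (metis imageI length_upt map_replicate_const)
  then show "x \<in> lim_set"
    unfolding limit_set_def using i(1) by (intro UN_I[of "\<lambda>_. i"]) auto
qed

lemma fixed_point_exists:
  assumes "i \<in> I"
  obtains p where "p \<in> fix_set" "p \<in> X" "T i p = p"
proof -
  have "\<exists>!x\<in>X. T i x = x"
    using compact_imp_complete[OF compact_X] base_point(2) c maps_X[OF assms] contraction[OF assms]
    by (intro Banach_fix) auto
  then show thesis using that assms by (auto simp: fixed_points_def)
qed

lemma fixed_points_nonempty: "fix_set \<noteq> {}"
  using index_nonempty fixed_point_exists by blast

lemma bounded_limit_set: "bounded lim_set" and bounded_fixed_points: "bounded fix_set"
  using compact_imp_bounded[OF compact_X] limit_set_subset fixed_points_subset
  by (blast intro: bounded_subset)+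

lemma limit_set_nonempty: "lim_set \<noteq> {}"
  using fixed_points_subset fixed_points_nonempty by blast

text \<open>The limit set is covered by the cylinders of the words \<open>w @ [i]\<close> at which the ratio first
  drops below \<open>r\<close>; for fixed \<open>w\<close> they all lie in the image under \<open>w\<close> of a neighbourhood of
  the fixed points of radius comparable to \<open>r / ratio w\<close>.\<close>

lemma covering_number_limit_set_le:
  assumes less: "hausdorff_dim lim_set < ereal t"
  obtains C1 C2 where "0 < C1" "0 < C2"
    "\<And>r M. 0 < r \<Longrightarrow> r \<le> 1 \<Longrightarrow>
      (\<And>R. r \<le> R \<Longrightarrow> R \<le> 1 \<Longrightarrow> real (covering_number R fix_set) \<le> M * (r / R) powr t) \<Longrightarrow>
      real (covering_number (C1 * r) lim_set) \<le> C2 * M"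
proof -
  have t: "0 < t" using hausdorff_dim_lessD(1)[OF less] .
  obtain L where L: "1 \<le> L" "\<And>w x y. w \<in> lists I \<Longrightarrow> x \<in> X \<Longrightarrow> y \<in> X \<Longrightarrow> dist (cyl w x) (cyl w y) \<le> L * ratio w * dist x y"
    using cyl_Lipschitz by metis
  obtain C where C: "0 < C" "\<And>W. finite W \<Longrightarrow> W \<subseteq> lists I \<Longrightarrow> (\<Sum>w\<in>W. ratio w powr t) \<le> C"
    using finite_word_sums_bounded[OF less] by metis
  \<comment> \<open>The point \<open>T i z\<close> and the fixed point of \<open>T i\<close> both
    lie in the cylinder of \<open>i\<close>, of diameter at most
    \<open>L * K * R * diameter X\<close>; the 1 accounts for the ball of radius \<open>R\<close>
    containing the fixed point.\<close>
  define B where "B = 1 + L * K * diameter X"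
  have "0 \<le> diameter X" by (simp add: compact_imp_bounded compact_X diameter_ge_0)
  then have B: "1 \<le> B" using L K by (simp add: B_def)
  define C1 where "C1 = 2 * L * B"
  have C1: "0 < C1" using L B by (simp add: C1_def)
  have main: "real (covering_number (C1 * r) lim_set) \<le> C * M"
    if r: "0 < r" "r \<le> 1" and M: "\<And>R. r \<le> R \<Longrightarrow> R \<le> 1 \<Longrightarrow> real (covering_number R fix_set) \<le> M * (r / R) powr t" for r M
  proof -
    have M0: "0 \<le> M" using M[of r] r by simp
    \<comment> \<open>Even for an infinite alphabet \<open>G\<close> is finite: each of its words
      contributes at least \<open>r powr t\<close> to a bounded sum.\<close>
    define G where "G = {w \<in> lists I. r \<le> ratio w}"
    have "finite G \<and> card G \<le> nat \<lceil>C / r powr t\<rceil>"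
    proof (rule finite_if_finite_subsets_card_bdd)
      fix W assume W: "W \<subseteq> G" "finite W"
      have "real (card W) * r powr t \<le> (\<Sum>w\<in>W. ratio w powr t)"
        unfolding sum_constant[symmetric] using W r t
        by (intro sum_mono powr_mono2) (auto simp: G_def)
      also have "\<dots> \<le> C" using W by (intro C(2)) (auto simp: G_def)
      finally have "real (card W) \<le> C / r powr t" using r by (simp add: field_simps)
      then show "card W \<le> nat \<lceil>C / r powr t\<rceil>" by linarith
    qed
    then have finG: "finite G" by simp
    have GI: "w \<in> lists I" "r \<le> ratio w" if "w \<in> G" for w using that by (auto simp: G_def)
    have "\<exists>P. finite P \<and> card P = covering_number (r / ratio w) fix_set \<and> fix_set \<subseteq> (\<Union>q\<in>P. ball q (r / ratio w))"
      if "w \<in> G" for w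
      using covering_number_cover[OF bounded_fixed_points, of "r / ratio w"] r GI[OF that] ratio_pos by (metis divide_pos_pos)
    then obtain P where P: "\<And>w. w \<in> G \<Longrightarrow> finite (P w)"
        "\<And>w. w \<in> G \<Longrightarrow> card (P w) = covering_number (r / ratio w) fix_set"
        "\<And>w. w \<in> G \<Longrightarrow> fix_set \<subseteq> (\<Union>q\<in>P w. ball q (r / ratio w))"
      by metis
    \<comment> \<open>The centre \<open>q\<close> need not lie in \<open>X\<close>, where
      \<open>cyl w\<close> is controlled, so a nearby point of \<open>X\<close> replaces it; this
      causes the factor 2 in \<open>C1\<close>.\<close>
    define pt where "pt w q = (SOME y. y \<in> X \<inter> ball q (B * (r / ratio w)))" for w q
    define D where "D = (\<Union>w\<in>G. (\<lambda>q. cyl w (pt w q)) ` P w)"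
    have "finite D" using finG P(1) by (auto simp: D_def)
    have "real (card D) \<le> C * M"
    proof -
      have "card D \<le> (\<Sum>w\<in>G. card ((\<lambda>q. cyl w (pt w q)) ` P w))"
        unfolding D_def by (rule card_UN_le[OF finG])
      also have "\<dots> \<le> (\<Sum>w\<in>G. card (P w))"
        by (intro sum_mono card_image_le P(1))
      finally have "real (card D) \<le> (\<Sum>w\<in>G. real (card (P w)))"
        by (simp flip: of_nat_sum)
      also have "\<dots> \<le> (\<Sum>w\<in>G. M * ratio w powr t)"
      proof (rule sum_mono)
        fix w assume w: "w \<in> G"
        have pos: "0 < ratio w" using GI[OF w] ratio_pos by blast
        \<comment> \<open>The hypothesis on \<open>M\<close> is applied at
          \<open>R = r / ratio w\<close>, where \<open>r / R\<close> is
          \<open>ratio w\<close>.\<close>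
        have "r \<le> r / ratio w" "r / ratio w \<le> 1"
          using GI[OF w] pos r ratio_le_1[of w] by (auto simp: field_simps)
        from M[OF this] show "real (card (P w)) \<le> M * ratio w powr t"
          using P(2)[OF w] r pos by simp
      qed
      also have "\<dots> = M * (\<Sum>w\<in>G. ratio w powr t)" by (simp add: sum_distrib_left)
      also have "\<dots> \<le> M * C" using M0 finG GI by (intro mult_left_mono C(2)) auto
      finally show ?thesis by (simp add: mult.commute)
    qed
    have "lim_set \<subseteq> (\<Union>z\<in>D. ball z (C1 * r))"
    proof
      fix x assume "x \<in> lim_set"
      then obtain \<gamma> where \<gamma>: "range \<gamma> \<subseteq> I" "\<And>n. 1 \<le> n \<Longrightarrow> x \<in> cyl (map \<gamma> [0..<n]) ` X"
        unfolding limit_set_def by blast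
      have \<gamma>I: "\<gamma> n \<in> I" for n using \<gamma>(1) by blast
      then have uI: "map \<gamma> [0..<n] \<in> lists I" for n by auto
      obtain n where "c ^ n < r" using real_arch_pow_inv[OF r(1) c(2)] by blast
      then have ex: "ratio (map \<gamma> [0..<n]) < r" using ratio_le_power[OF uI[of n]] by simp
      define k where "k = (LEAST n. ratio (map \<gamma> [0..<n]) < r)"
      have k: "ratio (map \<gamma> [0..<k]) < r"
        unfolding k_def using ex by (rule LeastI)
      then have "k \<noteq> 0" using r by (intro notI) simp
      then obtain m where m: "k = Suc m" by (cases k) auto
      define w where "w = map \<gamma> [0..<m]"
      define i where "i = \<gamma> m"
      have wi: "map \<gamma> [0..<k] = w @ [i]" by (simp add: m w_def i_def)
      have wI: "w \<in> lists I" and iI: "i \<in> I" using uI[of m] \<gamma>I by (auto simp: w_def i_def)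
      have "r \<le> ratio w"
        using not_less_Least[of m "\<lambda>n. ratio (map \<gamma> [0..<n]) < r"] m unfolding k_def[symmetric] w_def by simp
      then have w: "w \<in> G" using wI by (simp add: G_def)
      define R where "R = r / ratio w"
      have pos: "0 < ratio w" using ratio_pos[OF wI] .
      have "x \<in> cyl (w @ [i]) ` X" using \<gamma>(2)[of k] \<open>k \<noteq> 0\<close> wi by simp
      then obtain z where z: "z \<in> X" "x = cyl w (T i z)" by (auto simp: word_map_append)
      have Tz: "T i z \<in> X" using maps_X[OF iI] z(1) by blast
      have "ratio w * ratio [i] \<le> K * ratio (w @ [i])"
        using ratio_append(2)[OF wI, of "[i]"] iI by simp
      also have "\<dots> \<le> K * r" using k wi K by simp
      finally have ri: "ratio [i] \<le> K * R" using pos by (simp add: R_def field_simps)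
      \<comment> \<open>The ratio of the last letter has no positive lower bound in general, so the
        cylinder may be far smaller than \<open>r\<close>. The fixed point of the last map serves to
        locate it.\<close>
      obtain p where p: "p \<in> fix_set" "p \<in> X" "T i p = p" using fixed_point_exists[OF iI] .
      obtain q where q: "q \<in> P w" "p \<in> ball q R" using P(3)[OF w] p(1) unfolding R_def by blast
      have "dist (T i z) p \<le> L * ratio [i] * dist z p"
        using L(2)[of "[i]" z p] iI z(1) p by simp
      also have "\<dots> \<le> L * (K * R) * diameter X"
        using L(1) ri dist_le_diameter_X[OF z(1) p(2)] K pos r ratio_pos[of "[i]"] iI by (intro mult_mono) (auto simp: R_def)
      finally have "dist q (T i z) < B * R"
        using q(2) dist_triangle[of q "T i z" p] by (simp add: B_def algebra_simps dist_commute)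
      then have near: "T i z \<in> X \<inter> ball q (B * R)" using Tz by simp
      then have "pt w q \<in> X \<inter> ball q (B * R)"
        unfolding pt_def R_def by (rule someI)
      then have pt: "pt w q \<in> X" "dist q (pt w q) < B * R" by auto
      have "dist (cyl w (pt w q)) x \<le> L * ratio w * dist (pt w q) (T i z)"
        unfolding z(2) by (rule L(2)[OF wI pt(1) Tz])
      also have "\<dots> < L * ratio w * (2 * (B * R))"
      proof (rule mult_strict_left_mono)
        show "dist (pt w q) (T i z) < 2 * (B * R)"
          using pt(2) \<open>dist q (T i z) < B * R\<close> dist_triangle3[of "pt w q" "T i z" q] by linarith
      qed (use L(1) pos in simp)
      also have "\<dots> = C1 * r" using pos by (simp add: C1_def R_def)
      finally have "x \<in> ball (cyl w (pt w q)) (C1 * r)" by simp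
      then show "x \<in> (\<Union>z\<in>D. ball z (C1 * r))" using w q(1) unfolding D_def by blast
    qed
    then have "covering_number (C1 * r) lim_set \<le> card D"
      by (rule covering_number_le[OF \<open>finite D\<close>])
    with \<open>real (card D) \<le> C * M\<close> show ?thesis by linarith
  qed
  show thesis by (rule that[OF C1 C(1) main])
qed

section \<open>Dimension estimates and the criterion\<close>

text \<open>For \<open>t\<close> above both dimensions, the bound \<open>A * R powr - t\<close> for
  the fixed points is the covering hypothesis with \<open>M = A * r powr - t\<close>.\<close>

lemma upper_box_dim_limit_set_le:
  "upper_box_dim lim_set \<le> max (hausdorff_dim lim_set) (upper_box_dim fix_set)"
proof (rule ccontr)
  assume "\<not> ?thesis"
  then obtain t where t: "max (hausdorff_dim lim_set) (upper_box_dim fix_set) < ereal t" "ereal t < upper_box_dim lim_set"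
    using ereal_dense2 by (meson not_le)
  obtain C1 C2 where C: "0 < C1" "0 < C2"
    "\<And>r M. 0 < r \<Longrightarrow> r \<le> 1 \<Longrightarrow>
      (\<And>R. r \<le> R \<Longrightarrow> R \<le> 1 \<Longrightarrow> real (covering_number R fix_set) \<le> M * (r / R) powr t) \<Longrightarrow>
      real (covering_number (C1 * r) lim_set) \<le> C2 * M"
    using covering_number_limit_set_le[of t] t(1) by (metis max_less_iff_conj)
  obtain A where A: "0 < A" "\<And>R. 0 < R \<Longrightarrow> R \<le> 1 \<Longrightarrow> real (covering_number R fix_set) \<le> A * R powr - t"
    using covering_number_powr_bound[OF bounded_fixed_points fixed_points_nonempty, of t] t(1) by (metis max_less_iff_conj)
  have "real (covering_number s lim_set) \<le> C2 * A * C1 powr t * s powr - t" if s: "0 < s" "s < C1" for s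
  proof -
    define r where "r = s / C1"
    have r: "0 < r" "r < 1" "s = C1 * r" using s C(1) by (auto simp: r_def)
    have "real (covering_number s lim_set) \<le> C2 * (A * r powr - t)"
      unfolding r(3)
    proof (rule C(3))
      fix R assume R: "r \<le> R" "R \<le> 1"
      then have "0 < R" using r by linarith
      have "A * R powr - t = A * r powr - t * (r / R) powr t"
        using r(1) \<open>0 < R\<close> by (simp add: powr_divide powr_minus field_simps)
      then show "real (covering_number R fix_set) \<le> A * r powr - t * (r / R) powr t"
        using A(2)[OF \<open>0 < R\<close> R(2)] by linarith
    qed (use r in auto)
    also have "C2 * (A * r powr - t) = C2 * A * C1 powr t * s powr - t"
      using r C(1) by (simp add: powr_mult powr_minus)
    finally show ?thesis .
  qed
  then have "eventually (\<lambda>s. real (covering_number s lim_set) \<le> C2 * A * C1 powr t * s powr - t) (at_right 0)"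
    unfolding eventually_at_right_0_iff using C(1) by blast
  from upper_box_dim_leI[OF bounded_limit_set limit_set_nonempty this] t(2) show False by simp
qed

text \<open>At a scale \<open>r\<close> where the fixed points have few balls, the covering bound is applied with the
  scales \<open>R \<le> r powr \<theta>\<close> estimated through \<open>r\<close> and the coarser ones through the upper box
  dimension \<open>u\<close>; for \<open>\<theta>\<close> close to 1 both exponents are below \<open>u\<close>.\<close>

lemma lower_box_dim_limit_set_less:
  assumes "max (hausdorff_dim lim_set) (lower_box_dim fix_set) < upper_box_dim fix_set"
  shows "lower_box_dim lim_set < upper_box_dim fix_set"
proof -
  note F = bounded_fixed_points fixed_points_nonempty
  have "upper_box_dim fix_set \<noteq> \<infinity>"
    using upper_box_dim_le_DIM[OF F] by auto
  then obtain u where u: "upper_box_dim fix_set = ereal u"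
    using assms by (cases "upper_box_dim fix_set") auto
  obtain s where s: "lower_box_dim fix_set < ereal s" "s < u"
    using assms ereal_dense2[of "lower_box_dim fix_set" "upper_box_dim fix_set"] by (auto simp: u)
  obtain t where t: "hausdorff_dim lim_set < ereal t" "t < u"
    using assms ereal_dense2[of "hausdorff_dim lim_set" "upper_box_dim fix_set"] by (auto simp: u)
  have "0 < t" using hausdorff_dim_lessD(1)[OF t(1)] .
  \<comment> \<open>Chosen so that \<open>a * t + s\<close> stays below \<open>u\<close>; this
    exponent governs the fine scales.\<close>
  define a where "a = min (1 / 2) ((u - s) / (2 * t))"
  have a: "0 < a" "a \<le> 1 / 2" "a * t \<le> (u - s) / 2"
  proof -
    show "0 < a" using s(2) \<open>0 < t\<close> by (simp add: a_def)
    have "a * t \<le> (u - s) / (2 * t) * t" using \<open>0 < t\<close> by (intro mult_right_mono) (auto simp: a_def)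
    then show "a * t \<le> (u - s) / 2" using \<open>0 < t\<close> by simp
  qed (simp add: a_def)
  define \<theta> where "\<theta> = 1 - a"
  \<comment> \<open>Slightly above \<open>u\<close>, so that \<open>R powr - u'\<close> bounds the
    fixed points at all scales, yet \<open>\<theta> * (u' - t) = (1 - a * a) * (u - t)\<close> is
    still below \<open>u - t\<close>.\<close>
  define u' where "u' = u + a * (u - t)"
  define v where "v = max (a * t + s) (t + \<theta> * (u' - t))"
  have au: "0 < a * (u - t)" using a(1) t(2) by simp
  have "v < u"
  proof -
    have "a * t + s < u" using a(3) s(2) by (simp add: field_simps)
    moreover have "\<theta> * (u' - t) < u - t"
    proof -
      have "u' - t = (1 + a) * (u - t)" by (simp add: u'_def algebra_simps)
      then have "\<theta> * (u' - t) = (1 - a) * ((1 + a) * (u - t))" by (simp add: \<theta>_def)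
      also have "\<dots> = (1 - a * a) * (u - t)" by (simp add: algebra_simps)
      also have "\<dots> < 1 * (u - t)" using a(1) t(2) by (intro mult_strict_right_mono) auto
      finally show ?thesis by simp
    qed
    ultimately show ?thesis by (simp add: v_def)
  qed
  have "upper_box_dim fix_set < ereal u'" using au by (simp add: u u'_def)
  from covering_number_powr_bound[OF F this]
  obtain A where A: "0 < A" "\<And>R. 0 < R \<Longrightarrow> R \<le> 1 \<Longrightarrow> real (covering_number R fix_set) \<le> A * R powr - u'"
    by metis
  obtain C1 C2 where C: "0 < C1" "0 < C2"
    "\<And>r M. 0 < r \<Longrightarrow> r \<le> 1 \<Longrightarrow>
      (\<And>R. r \<le> R \<Longrightarrow> R \<le> 1 \<Longrightarrow> real (covering_number R fix_set) \<le> M * (r / R) powr t) \<Longrightarrow>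
      real (covering_number (C1 * r) lim_set) \<le> C2 * M"
    using covering_number_limit_set_le[OF t(1)] by metis
  have bound: "real (covering_number (C1 * r) lim_set) \<le> C2 * ((A + 1) * r powr - v)"
    if r: "0 < r" "r < 1" "real (covering_number r fix_set) \<le> r powr - s" for r
  proof (rule C(3))
    fix R assume R: "r \<le> R" "R \<le> 1"
    then have "0 < R" using r by linarith
    show "real (covering_number R fix_set) \<le> (A + 1) * r powr - v * (r / R) powr t"
    proof (cases "R \<le> r powr \<theta>")
      case True
      \<comment> \<open>Fine scales: the count at \<open>R\<close> is at most that at
        \<open>r\<close>, and \<open>r / R\<close> is at least \<open>r powr a\<close>.\<close>
      have "real (covering_number R fix_set) \<le> r powr - s"
        using covering_number_antimono[OF F(1) r(1) R(1)] r(3) by linarith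
      also have "\<dots> \<le> r powr (- v + a * t)"
        using r by (intro powr_mono') (auto simp: v_def)
      also have "\<dots> = r powr - v * (r powr a) powr t"
        by (simp only: powr_add powr_powr)
      also have "r powr a = r / r powr \<theta>"
        using r by (simp add: \<theta>_def powr_diff)
      also have "r powr - v * (r / r powr \<theta>) powr t \<le> r powr - v * (r / R) powr t"
        using True r \<open>0 < R\<close> \<open>0 < t\<close> by (intro mult_left_mono powr_mono2 divide_left_mono) auto
      also have "\<dots> \<le> (A + 1) * r powr - v * (r / R) powr t"
        using A(1) mult_right_mono[of 1 "A + 1" "r powr - v * (r / R) powr t"] by (simp add: mult.assoc)
      finally show ?thesis .
    next
      case False
      \<comment> \<open>Coarse scales: the excess exponent \<open>u' - t\<close> is paid at
        \<open>r powr \<theta>\<close> instead of \<open>r\<close>.\<close>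
      have "real (covering_number R fix_set) \<le> A * R powr - u'"
        using A(2) \<open>0 < R\<close> R(2) by blast
      also have "R powr - u' = R powr - (u' - t) * R powr - t"
        by (simp add: powr_add[symmetric])
      also have "R powr - (u' - t) \<le> (r powr \<theta>) powr - (u' - t)"
        using False r au t(2) by (intro powr_mono2') (auto simp: u'_def)
      also have "(r powr \<theta>) powr - (u' - t) \<le> r powr (- v + t)"
        unfolding powr_powr using r by (intro powr_mono') (auto simp: v_def algebra_simps)
      also have "A * (r powr (- v + t) * R powr - t) = A * r powr - v * (r / R) powr t"
      proof -
        have "(r / R) powr t = r powr t * R powr - t"
          using r(1) \<open>0 < R\<close> by (simp add: powr_divide powr_minus_divide)
        then show ?thesis by (simp only: powr_add mult.assoc)
      qed
      also have "\<dots> \<le> (A + 1) * r powr - v * (r / R) powr t"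
        by (intro mult_right_mono) auto
      finally show ?thesis using A(1) by (simp add: mult_right_mono)
    qed
  qed (use r in auto)
  have "frequently (\<lambda>s. real (covering_number s lim_set) \<le> C2 * (A + 1) * C1 powr v * s powr - v) (at_right 0)"
    unfolding frequently_at_right_0_iff
  proof (intro allI impI)
    fix b :: real assume "0 < b"
    then have "0 < min 1 (b / C1)" using C(1) by simp
    then obtain r where r: "0 < r" "r < min 1 (b / C1)" "real (covering_number r fix_set) \<le> r powr - s"
      using lower_box_dim_lessD[OF F s(1)] unfolding frequently_at_right_0_iff by blast
    then have "r < 1" by simp
    have "C2 * ((A + 1) * r powr - v) = C2 * (A + 1) * C1 powr v * (C1 * r) powr - v"
      using C(1) r(1) by (simp add: powr_mult powr_minus field_simps)
    then have "real (covering_number (C1 * r) lim_set) \<le> C2 * (A + 1) * C1 powr v * (C1 * r) powr - v"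
      using bound[OF r(1) \<open>r < 1\<close> r(3)] by linarith
    moreover have "0 < C1 * r" "C1 * r < b" using r C(1) by (auto simp: field_simps)
    ultimately show "\<exists>s. 0 < s \<and> s < b \<and> real (covering_number s lim_set) \<le> C2 * (A + 1) * C1 powr v * s powr - v"
      by blast
  qed
  from lower_box_dim_leI[OF bounded_limit_set limit_set_nonempty this]
  have "lower_box_dim lim_set \<le> ereal v" .
  then show ?thesis using \<open>v < u\<close> unfolding u by (simp add: le_less_trans)
qed

text \<open>If the inequality fails, the lower box dimension of the limit set is below the upper one
  of \<open>fix_set\<close>, hence below its own upper one. If it holds, the upper box dimension of
  the limit set is at most the right-hand maximum, which never exceeds its lower box
  dimension.\<close>

theorem box_dim_exists_iff:
  "lower_box_dim lim_set = upper_box_dim lim_set \<longleftrightarrow>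
    upper_box_dim fix_set \<le> max (hausdorff_dim lim_set) (lower_box_dim fix_set)"
proof
  note mono = box_dim_mono[OF bounded_limit_set fixed_points_nonempty fixed_points_subset]
  show "upper_box_dim fix_set \<le> max (hausdorff_dim lim_set) (lower_box_dim fix_set)"
    if "lower_box_dim lim_set = upper_box_dim lim_set"
    using that lower_box_dim_limit_set_less mono(2) by (metis not_le)
  assume "upper_box_dim fix_set \<le> max (hausdorff_dim lim_set) (lower_box_dim fix_set)"
  then have "max (hausdorff_dim lim_set) (upper_box_dim fix_set) \<le> max (hausdorff_dim lim_set) (lower_box_dim fix_set)"
    by simp
  also have "\<dots> \<le> lower_box_dim lim_set"
    using hausdorff_dim_le_lower_box_dim[OF bounded_limit_set limit_set_nonempty] mono(1) by simp
  finally have "upper_box_dim lim_set \<le> lower_box_dim lim_set"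
    using upper_box_dim_limit_set_le by (rule order_trans[rotated])
  then show "lower_box_dim lim_set = upper_box_dim lim_set"
    using lower_box_dim_le_upper by (rule antisym[rotated])
qed

end

section \<open>Passage between the maps on \<open>X\<close> and their extensions\<close>

lemma word_map_cong:
  assumes "\<And>i x. i \<in> I \<Longrightarrow> x \<in> X \<Longrightarrow> T i x = S i x" "\<And>i. i \<in> I \<Longrightarrow> S i ` X \<subseteq> X" "w \<in> lists I" "x \<in> X"
  shows "word_map T w x = word_map S w x"
proof -
  have "word_map T w x = word_map S w x \<and> word_map S w x \<in> X"
    using assms(3) by (induction w) (use assms in \<open>auto simp: image_subset_iff\<close>)
  then show ?thesis by simp
qed

lemma limit_set_cong:
  assumes "\<And>i x. i \<in> I \<Longrightarrow> x \<in> X \<Longrightarrow> T i x = S i x" "\<And>i. i \<in> I \<Longrightarrow> S i ` X \<subseteq> X"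
  shows "limit_set X I T = limit_set X I S"
  unfolding limit_set_def
proof (intro SUP_cong INF_cong refl)
  fix \<gamma> n assume "\<gamma> \<in> {\<gamma> :: nat \<Rightarrow> _. range \<gamma> \<subseteq> I}"
  then have "\<gamma> k \<in> I" for k by blast
  then have "map \<gamma> [0..<n] \<in> lists I" by auto
  then show "word_map T (map \<gamma> [0..<n]) ` X = word_map S (map \<gamma> [0..<n]) ` X"
    using word_map_cong[of I X T S, OF assms] by (intro image_cong) auto
qed

theorem theoremB:
  fixes X :: "(real^'d) set" and I :: "'i set" and S :: "'i \<Rightarrow> real^'d \<Rightarrow> real^'d"
  assumes "CIFS X I S"
  shows "lower_box_dim (limit_set X I S) = upper_box_dim (limit_set X I S) \<longleftrightarrow>
         upper_box_dim (fixed_points X I S)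
           \<le> max (hausdorff_dim (limit_set X I S)) (lower_box_dim (fixed_points X I S))"
proof -
  interpret CIFS X I S by fact
  obtain c where c: "0 < c" "c < 1"
    and contr: "\<And>i x y. i \<in> I \<Longrightarrow> x \<in> X \<Longrightarrow> y \<in> X \<Longrightarrow> x \<noteq> y \<Longrightarrow> norm (S i x - S i y) \<le> c * norm (x - y)"
    using uniformly_contracting by blast
  obtain V T where VT: "open V \<and> bounded V \<and> connected V \<and> X \<subseteq> V \<and>
      (\<exists>\<epsilon>. 0 < \<epsilon> \<and> \<epsilon> \<le> 1 \<and> (\<forall>i\<in>I. (\<forall>x\<in>X. T i x = S i x) \<and> T i ` V \<subseteq> V \<and>
        conformal_on (T i) V \<and> C1_holder_diffeo_on \<epsilon> (T i) V)) \<and>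
      (\<exists>K\<ge>1. \<forall>w \<in> lists I. \<forall>x\<in>V. \<forall>y\<in>V. stretch (word_map T w) x \<le> K * stretch (word_map T w) y)"
    using conformality_and_bounded_distortion by (elim exE) (rule that)
  then have V: "open V" "X \<subseteq> V"
    and T_all: "\<exists>\<epsilon>. 0 < \<epsilon> \<and> \<epsilon> \<le> 1 \<and> (\<forall>i\<in>I. (\<forall>x\<in>X. T i x = S i x) \<and> T i ` V \<subseteq> V \<and>
        conformal_on (T i) V \<and> C1_holder_diffeo_on \<epsilon> (T i) V)"
    by (simp_all only:)
  have T: "T i x = S i x" if "i \<in> I" "x \<in> X" for i x
    using T_all that by (elim exE conjE) blast
  have TV: "T i ` V \<subseteq> V" "conformal_on (T i) V" if "i \<in> I" for i
    using T_all that by (elim exE conjE; simp)+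
  obtain K where K: "1 \<le> K" "\<forall>w \<in> lists I. \<forall>x\<in>V. \<forall>y\<in>V.
      stretch (word_map T w) x \<le> K * stretch (word_map T w) y"
    using VT by (elim exE conjE) (rule that)
  have img: "T i ` A = S i ` A" if "i \<in> I" "A \<subseteq> X" for i A
    using T that by (intro image_cong) auto
  \<comment> \<open>On subsets of \<open>X\<close> the extensions have the same images as the given
    maps, which transfers invariance, injectivity, contraction and the open set condition.\<close>
  interpret conformal_system X V I T c K
  proof
    show "T i ` X \<subseteq> X" if "i \<in> I" for i using img[OF that] maps_into[OF that] by simp
    show "inj_on (T i) X" if "i \<in> I" for i
      using injective[OF that] T[OF that] by (simp cong: inj_on_cong)
    show "dist (T i x) (T i y) \<le> c * dist x y" if "i \<in> I" "x \<in> X" "y \<in> X" for i x y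
      using contr[OF that] T that by (cases "x = y") (auto simp: dist_norm)
    show "T i ` interior X \<subseteq> interior X" if "i \<in> I" for i
      using img[OF that interior_subset] interior_invariant[OF that] by simp
    show "T i ` interior X \<inter> T j ` interior X = {}" if "i \<in> I" "j \<in> I" "i \<noteq> j" for i j
      using img interior_subset interior_disjoint[OF that] that by metis
  qed (use compact_X connected_X index_nonempty interior_nonempty V K c TV in auto)
  have "limit_set X I T = limit_set X I S"
    using T maps_into by (rule limit_set_cong)
  moreover have "fixed_points X I T = fixed_points X I S"
    using T by (auto simp: fixed_points_def)
  ultimately show ?thesis using box_dim_exists_iff by simp
qed

end
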